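(* Let $L$ be an adev rational pce language (over a finite totally ordered alphabet) and let $\lambda$ be its modulus, with $\lambda>1$. If every (non-empty) quotient of $L$ whose modulus is equal to $\lambda$ is adev, then $L$ has a carry propagation and $$\mathsf{CP}_L=\frac{\lambda}{\lambda-1}.$$
   Context: $A=\{0,1,\ldots,r-1\}$ is a finite alphabet with its natural order, $A^*$ the set of words over $A$, $|w|$ the length of $w$. A language is rational if it is accepted by a finite automaton. The radix order on $A^*$: $v$ is less than $w$ if $|v|<|w|$, or if $|v|=|w|$ and $v$ is lexicographically less than $w$. A language $L\subseteq A^*$ is a pce language if every prefix of a word of $L$ is in $L$ and every word of $L$ is a strict prefix of another word of $L$. Languages considered as numeration systems are infinite (for a pce language, this means non-empty; every non-empty quotient of a pce language is then infinite). Enumerate $L$ in increasing radix order as $w_0,w_1,w_2,\ldots$. For words $u,v$: if $|u|=|v|$, $\Delta(u,v)$ is $|u|$ minus the length of the longest common prefix of $u$ and $v$; if $|u|\neq|v|$, $\Delta(u,v)=\max(|u|,|v|)$. Set $\mathsf{cp}_L(i)=\Delta(w_i,w_{i+1})$. The carry propagation of $L$ is the (finite) limit, if it exists, $\mathsf{CP}_L=\lim_{N\to\infty}\frac1N\sum_{i=0}^{N-1}\mathsf{cp}_L(i)$. For $w\in A^*$, the quotient of $L$ by $w$ is $w^{-1}L=\{v\in A^*: wv\in L\}$. For an infinite rational language $K$, let $\mathbf{u}_K(\ell)$ be the number of words of $K$ of length $\ell$ and $\mathsf{g}_K(z)=\sum_{\ell\ge0}\mathbf{u}_K(\ell)z^\ell$,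 a rational function which is not a polynomial. Write $\mathsf{g}_K(z)=T(z)+\frac{R(z)}{S(z)}$ with $T,R,S\in\mathbb{Q}[z]$, $R$ and $S$ coprime, $\deg R<\deg S$, $S(0)\neq0$, and let $\mathsf{P}_K(z)=z^{\deg S}S(1/z)$. The eigenvalues of $K$ are the complex zeroes of $\mathsf{P}_K$, with their multiplicities. The modulus of $K$ is the maximum $\mu$ of the moduli of its eigenvalues; it is known that $\mu$ is itself an eigenvalue of $K$. The language $K$ is adev (has an almost dominating eigenvalue) if every eigenvalue of modulus $\mu$ other than $\mu$ itself has multiplicity strictly less than the multiplicity of the eigenvalue $\mu$. *)

theory Defs
  imports
    "HOL-Complex_Analysis.Complex_Analysis"
    "HOL-Computational_Algebra.Computational_Algebra"
    "HOL-Library.Sublist"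
begin

text \<open>Words are lists over \<open>nat\<close>; the alphabet \<open>{0, \<dots>, r - 1}\<close> is \<open>{..<r}\<close>, so that the set
  of all words over it is \<open>lists {..<r}\<close>.\<close>

subsection \<open>Rational languages and pce languages\<close>

text \<open>\<open>run E p w q\<close>: the transition relation \<open>E\<close> admits a path from \<open>p\<close> to \<open>q\<close> with label \<open>w\<close>.\<close>

inductive run :: "('q \<times> 'a \<times> 'q) set \<Rightarrow> 'q \<Rightarrow> 'a list \<Rightarrow> 'q \<Rightarrow> bool" for E where
  run_Nil: "run E p [] p"
| run_Cons: "(p, a, q) \<in> E \<Longrightarrow> run E q w q' \<Longrightarrow> run E p (a # w) q'"

text \<open>Automata may be nondeterministic. Since the state set is finite, it is no restriction to
  take the states to be natural numbers.\<close>

definition rational_language :: "'a set \<Rightarrow> 'a list set \<Rightarrow> bool" where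
  "rational_language A L \<longleftrightarrow>
    (\<exists>(Q :: nat set) I T E. finite Q \<and> I \<subseteq> Q \<and> T \<subseteq> Q \<and> E \<subseteq> Q \<times> A \<times> Q \<and>
       L = {w. \<exists>p\<in>I. \<exists>q\<in>T. run E p w q})"

definition pce_language :: "'a set \<Rightarrow> 'a list set \<Rightarrow> bool" where
  "pce_language A L \<longleftrightarrow>
    L \<subseteq> lists A \<and>
    (\<forall>w\<in>L. \<forall>v. prefix v w \<longrightarrow> v \<in> L) \<and>
    (\<forall>w\<in>L. \<exists>v\<in>L. strict_prefix w v)"

definition quotient_language :: "'a list \<Rightarrow> 'a list set \<Rightarrow> 'a list set" where
  "quotient_language w L = {v. w @ v \<in> L}"

subsection \<open>Radix order and carry propagation\<close>

definition radix_order :: "(nat list \<times> nat list) set" where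
  "radix_order = lenlex {(a, b). a < b}"

text \<open>For an infinite language over a finite alphabet the increasing enumeration exists and is
  unique; its value on other languages is irrelevant.\<close>

definition radix_enum :: "nat list set \<Rightarrow> nat \<Rightarrow> nat list" where
  "radix_enum L = (THE w. range w = L \<and> (\<forall>i j. i < j \<longrightarrow> (w i, w j) \<in> radix_order))"

definition word_Delta :: "'a list \<Rightarrow> 'a list \<Rightarrow> nat" where
  "word_Delta u v =
    (if length u = length v then length u - length (longest_common_prefix u v)
     else max (length u) (length v))"

definition cp :: "nat list set \<Rightarrow> nat \<Rightarrow> nat" where
  "cp L i = word_Delta (radix_enum L i) (radix_enum L (Suc i))"

definition cp_mean :: "nat list set \<Rightarrow> nat \<Rightarrow> real" where
  "cp_mean L N = (1 / real N) * (\<Sum>i<N. real (cp L i))"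

definition has_carry_propagation :: "nat list set \<Rightarrow> bool" where
  "has_carry_propagation L \<longleftrightarrow> convergent (cp_mean L)"

definition CP :: "nat list set \<Rightarrow> real" where
  "CP L = lim (cp_mean L)"

subsection \<open>Generating function, eigenvalues and modulus\<close>

definition num_words :: "'a list set \<Rightarrow> nat \<Rightarrow> nat" where
  "num_words K l = card {w \<in> K. length w = l}"

definition gen_fun :: "'a list set \<Rightarrow> rat fps" where
  "gen_fun K = Abs_fps (\<lambda>l. of_nat (num_words K l))"

text \<open>\<open>gen_fun K = T + R / S\<close>, where the fraction is read as a power series, which is possible
  as \<open>S\<close> does not vanish at 0.\<close>

definition gen_fun_decomp :: "'a list set \<Rightarrow> rat poly \<Rightarrow> rat poly \<Rightarrow> rat poly \<Rightarrow> bool" where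
  "gen_fun_decomp K T R S \<longleftrightarrow>
    gen_fun K = fps_of_poly T + fps_of_poly R / fps_of_poly S \<and>
    coprime R S \<and> degree R < degree S \<and> poly S 0 \<noteq> 0"

text \<open>For an infinite rational language such an \<open>S\<close> exists and is unique up to a nonzero constant
  factor, which has no influence on zeroes and multiplicities; hence the choice. The
  polynomial \<open>reflect_poly S\<close> is \<open>z^(degree S) * S(1/z)\<close>.\<close>

definition eigen_poly :: "'a list set \<Rightarrow> rat poly" where
  "eigen_poly K = reflect_poly (SOME S. \<exists>T R. gen_fun_decomp K T R S)"

definition eigen_poly_complex :: "'a list set \<Rightarrow> complex poly" where
  "eigen_poly_complex K = map_poly of_rat (eigen_poly K)"

definition eigenvalues :: "'a list set \<Rightarrow> complex set" where
  "eigenvalues K = {x. poly (eigen_poly_complex K) x = 0}"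

definition eigen_mult :: "'a list set \<Rightarrow> complex \<Rightarrow> nat" where
  "eigen_mult K x = order x (eigen_poly_complex K)"

definition lang_modulus :: "'a list set \<Rightarrow> real" where
  "lang_modulus K = Max (cmod ` eigenvalues K)"

definition adev :: "'a list set \<Rightarrow> bool" where
  "adev K \<longleftrightarrow>
    (\<forall>x\<in>eigenvalues K. cmod x = lang_modulus K \<and> x \<noteq> complex_of_real (lang_modulus K) \<longrightarrow>
       eigen_mult K x < eigen_mult K (complex_of_real (lang_modulus K)))"

end

theory Submission
  imports Defs "HOL-Computational_Algebra.Field_as_Ring"
begin

text \<open>
  Write \<open>u n\<close> for the number of words of length \<open>n\<close> of \<open>L\<close>, put \<open>\<alpha> = \<lambda> / (\<lambda> - 1)\<close>, and compare the sum
  \<open>C\<close> of the first \<open>N\<close> carry propagations with \<open>\<alpha> * N\<close>. Let \<open>w\<close> be the word of index \<open>N\<close> and \<open>n\<close>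
  its length.

  The distance of two words of the same length \<open>l\<close> is the number of \<open>k \<le> l\<close> such that their prefixes of
  length \<open>k\<close> differ. As every word of \<open>L\<close> can be prolonged inside \<open>L\<close>, the prefixes of length \<open>k\<close> of
  the successive words of length \<open>l\<close> run in order through all words of \<open>L\<close> of length \<open>k\<close>. Counting
  their changes gives
  \<open>C = (\<Sum>l<n. \<Sum>k\<le>l. u k) + (\<Sum>k\<le>n. D k)\<close> and \<open>N = (\<Sum>l<n. u l) + D n\<close>, where \<open>D k\<close> is the number of
  words of \<open>L\<close> of length \<open>k\<close> below the prefix of length \<open>k\<close> of \<open>w\<close> (\<open>sum_cp_eq\<close>, \<open>rank_eq\<close>).
  A word counted by \<open>D k\<close> leaves \<open>w\<close> at some position through a smaller letter, and what follows is
  an arbitrary word of a quotient of \<open>L\<close>. Hence \<open>C - \<alpha> * N\<close> is a sum, over the lengths \<open>m < n\<close>, of at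
  most \<open>1 + r\<close> values at \<open>m\<close> of the defects \<open>(\<Sum>k\<le>m. u\<^sub>K k) - \<alpha> * u\<^sub>K m\<close> of quotients \<open>K\<close>
  (\<open>lex_rank_defect_bound\<close>).

  There are finitely many quotients, so it is enough that the defect of each of them is \<open>o(u)\<close>: then
  \<open>C - \<alpha> * N\<close> is \<open>o(\<Sum>m<n. u m)\<close> up to a constant, and \<open>(\<Sum>m<n. u m) \<le> N\<close>. The defects are sums of the
  differences \<open>u\<^sub>K (m + 1) - \<lambda> * u\<^sub>K m\<close> (\<open>defect_eq\<close>), and \<open>u\<close> grows exponentially, so it is enough
  that these differences are \<open>o(u)\<close>. If the modulus of \<open>K\<close> is \<open>\<lambda>\<close>, then \<open>K\<close> is adev, the pole
  \<open>1 / \<lambda>\<close> of its generating function has a higher order than all other poles on its circle, and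
  \<open>u\<^sub>K (m + 1) / u\<^sub>K m\<close> tends to \<open>\<lambda>\<close> (\<open>adev_ratio\<close>), while \<open>u\<^sub>K = O(u)\<close>. If the modulus is smaller,
  \<open>u\<^sub>K\<close> itself is \<open>o(u)\<close> (\<open>num_words_below_modulus\<close>). It cannot be larger, again because
  \<open>u\<^sub>K = O(u)\<close> (\<open>modulus_le_growth\<close>).

  All this presupposes that the eigenvalues of a quotient come from an actual decomposition of its
  generating function: the generating functions of the quotients solve a linear system over the
  rational power series (\<open>rational_gen_fun\<close>).
\<close>

section \<open>The radix enumeration\<close>

abbreviation radix_less :: "nat list \<Rightarrow> nat list \<Rightarrow> bool"  (infix "\<sqsubset>" 50) where
  "x \<sqsubset> y \<equiv> (x, y) \<in> radix_order"

lemma radix_less_irrefl [simp]: "\<not> x \<sqsubset> x"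
  by (auto simp: radix_order_def lenlex_irreflexive)

lemma radix_less_trans: "x \<sqsubset> y \<Longrightarrow> y \<sqsubset> z \<Longrightarrow> x \<sqsubset> z"
  unfolding radix_order_def by (erule (1) lenlex_trans) (auto simp: trans_def)

lemma radix_less_total: "x \<sqsubset> y \<or> x = y \<or> y \<sqsubset> x"
proof -
  have "total (lenlex {(a :: nat, b). a < b})"
    by (rule total_lenlex) (auto simp: total_on_def)
  then show ?thesis
    unfolding radix_order_def total_on_def by blast
qed

lemma wf_radix_order: "wf radix_order"
  unfolding radix_order_def by (intro wf_lenlex wf)

lemma radix_less_length: "x \<sqsubset> y \<Longrightarrow> length x \<le> length y"
  unfolding radix_order_def by (rule lenlex_length)

lemma radix_less_shorter: "length x < length y \<Longrightarrow> x \<sqsubset> y"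
  by (auto simp: radix_order_def lenlex_conv)

lemma radix_less_Cons:
  "length x = length y \<Longrightarrow> a # x \<sqsubset> b # y \<longleftrightarrow> a < b \<or> a = b \<and> x \<sqsubset> y"
  by (auto simp: radix_order_def Cons_lenlex_iff)

lemma radix_less_append:
  "x \<sqsubset> y \<Longrightarrow> length x = length y \<Longrightarrow> length u = length v \<Longrightarrow> x @ u \<sqsubset> y @ v"
  unfolding radix_order_def by (rule lenlex_append1)

lemma radix_less_takeD:
  assumes "take k x \<sqsubset> take k y" "length x = length y"
  shows "x \<sqsubset> y"
  using radix_less_append[OF assms(1), of "drop k x" "drop k y"] assms(2) by simp

lemma take_radix_mono:
  assumes "x \<sqsubset> y" "length x = length y" "take k x \<noteq> take k y"
  shows "take k x \<sqsubset> take k y"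
  using assms radix_less_takeD radix_less_total radix_less_trans radix_less_irrefl by metis

lemma take_eq_take_iff_lcp:
  assumes "length x = length y" "k \<le> length x"
  shows "take k x = take k y \<longleftrightarrow> k \<le> length (longest_common_prefix x y)"
  using assms
proof (induction x y arbitrary: k rule: list_induct2')
  case (4 a x b y)
  then show ?case by (cases k) auto
qed auto

lemma finite_words:
  assumes "K \<subseteq> lists {..<r::nat}"
  shows "finite {w \<in> K. length w = n}" "finite {w \<in> K. w \<sqsubset> x}"
proof -
  have fin: "finite {w. set w \<subseteq> {..<r} \<and> length w \<le> m}" for m
    by (rule finite_lists_length_le) simp
  show "finite {w \<in> K. length w = n}"
    by (rule finite_subset[OF _ fin[of n]]) (use assms in auto)
  show "finite {w \<in> K. w \<sqsubset> x}"
    by (rule finite_subset[OF _ fin[of "length x"]]) (use assms radix_less_length in auto)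
qed

definition radix_rank :: "nat list set \<Rightarrow> nat list \<Rightarrow> nat" where
  "radix_rank L x = card {v \<in> L. v \<sqsubset> x}"

lemma radix_rank_strict_mono:
  assumes "L \<subseteq> lists {..<r}" "x \<in> L" "x \<sqsubset> y"
  shows "radix_rank L x < radix_rank L y"
  unfolding radix_rank_def
proof (rule psubset_card_mono)
  have "x \<in> {v \<in> L. v \<sqsubset> y}" "x \<notin> {v \<in> L. v \<sqsubset> x}" using assms by auto
  then show "{v \<in> L. v \<sqsubset> x} \<subset> {v \<in> L. v \<sqsubset> y}"
    using radix_less_trans[OF _ assms(3)] by blast
qed (rule finite_words(2)[OF assms(1)])

lemma radix_rank_inj:
  assumes "L \<subseteq> lists {..<r}"
  shows "inj_on (radix_rank L) L"
proof (rule inj_onI)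
  fix x y assume "x \<in> L" "y \<in> L" "radix_rank L x = radix_rank L y"
  then show "x = y"
    using radix_less_total[of x y] radix_rank_strict_mono[OF assms] by fastforce
qed

text \<open>A word of least position among those with at least \<open>n\<close> predecessors has exactly \<open>n\<close> of them: its
  predecessors have distinct ranks below \<open>n\<close>.\<close>

lemma radix_rank_surj:
  assumes L: "L \<subseteq> lists {..<r}" and inf: "infinite L"
  shows "\<exists>x\<in>L. radix_rank L x = n"
proof -
  have "infinite (radix_rank L ` L)"
    using inf radix_rank_inj[OF L] by (simp add: finite_image_iff)
  then obtain x0 where "x0 \<in> L" "n \<le> radix_rank L x0"
    unfolding infinite_nat_iff_unbounded_le by auto
  then have "x0 \<in> {x \<in> L. n \<le> radix_rank L x}" by simp
  from wfE_min[OF wf_radix_order this]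
  obtain x where x: "x \<in> L" "n \<le> radix_rank L x"
      and min: "\<And>v. v \<sqsubset> x \<Longrightarrow> v \<in> L \<Longrightarrow> radix_rank L v < n"
    by (metis (no_types, lifting) mem_Collect_eq not_le)
  have "radix_rank L x \<le> card {..<n}"
    unfolding radix_rank_def[of L x]
    by (rule card_inj_on_le[of "radix_rank L"])
       (use min inj_on_subset[OF radix_rank_inj[OF L], of "{v \<in> L. v \<sqsubset> x}"] in auto)
  then show ?thesis using x by auto
qed

text \<open>Any increasing enumeration sends \<open>i\<close> to a word with exactly \<open>i\<close> predecessors. This gives uniqueness
  and describes \<open>radix_enum\<close> by ranks.\<close>

lemma radix_enum:
  assumes L: "L \<subseteq> lists {..<r}" and inf: "infinite L"
  shows "radix_enum L i \<in> L" "radix_rank L (radix_enum L i) = i"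
proof -
  let ?P = "\<lambda>w. range w = L \<and> (\<forall>i j. i < j \<longrightarrow> (w i, w j) \<in> radix_order)"
  have rank: "radix_rank L (w j) = j" if "?P w" for w j
  proof -
    have "inj w"
      by (rule linorder_injI) (use that radix_less_irrefl in metis)
    have "i < j" if "w i \<sqsubset> w j" for i
      using that \<open>?P w\<close> radix_less_trans radix_less_irrefl by (metis linorder_neqE_nat)
    then have "{v \<in> L. v \<sqsubset> w j} = w ` {..<j}"
      using \<open>?P w\<close> by auto
    then show ?thesis
      using \<open>inj w\<close> by (simp add: radix_rank_def card_image inj_on_subset)
  qed
  obtain w where w: "\<And>i. w i \<in> L" "\<And>i. radix_rank L (w i) = i"
    using radix_rank_surj[OF assms] by metis
  have "?P w"
  proof (intro conjI allI impI)
    show "range w = L"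
    proof (intro equalityI subsetI)
      fix x assume "x \<in> L"
      then have "w (radix_rank L x) = x"
        by (intro inj_onD[OF radix_rank_inj[OF L]] w)
      then show "x \<in> range w" by (metis rangeI)
    qed (use w(1) in auto)
    fix i j :: nat assume "i < j"
    then show "w i \<sqsubset> w j"
      using w radix_less_total[of "w i" "w j"] radix_rank_strict_mono[OF L w(1), of j "w i"]
      by (metis less_asym less_irrefl_nat)
  qed
  moreover have "w' = w" if "?P w'" for w'
  proof
    fix i
    have "w' i \<in> L" using that by blast
    then show "w' i = w i"
      by (intro inj_onD[OF radix_rank_inj[OF L]] w) (simp_all add: rank[OF that] w)
  qed
  ultimately have "?P (radix_enum L)"
    unfolding radix_enum_def by (rule theI)
  then show "radix_enum L i \<in> L" "radix_rank L (radix_enum L i) = i"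
    using rank by blast+
qed

section \<open>Counting the changes of prefixes\<close>

definition lex_rank :: "nat list set \<Rightarrow> nat list \<Rightarrow> nat" where
  "lex_rank K w = card {x \<in> K. length x = length w \<and> x \<sqsubset> w}"

lemma radix_rank_eq:
  assumes "K \<subseteq> lists {..<r}"
  shows "radix_rank K w = (\<Sum>l<length w. num_words K l) + lex_rank K w"
proof -
  have eq: "{v \<in> K. v \<sqsubset> w} = (\<Union>l<length w. {v \<in> K. length v = l})
           \<union> {v \<in> K. length v = length w \<and> v \<sqsubset> w}"
    by (auto dest: radix_less_length intro: radix_less_shorter)
  have "card (\<Union>l<length w. {v \<in> K. length v = l}) = (\<Sum>l<length w. num_words K l)"
    unfolding num_words_def using finite_words(1)[OF assms] by (subst card_UN_disjoint) auto
  moreover have "finite {v \<in> K. length v = length w \<and> v \<sqsubset> w}"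
    using finite_words(2)[OF assms, of w] by (rule rev_finite_subset) auto
  ultimately show ?thesis
    unfolding radix_rank_def eq lex_rank_def
    by (subst card_Un_disjoint) (use finite_words(1)[OF assms] in auto)
qed

lemma pce_extend:
  assumes "pce_language A L" "x \<in> L" "length x \<le> n"
  shows "\<exists>y. x @ y \<in> L \<and> length (x @ y) = n"
  using assms(3)
proof (induction n rule: dec_induct)
  case base
  show ?case using assms(2) by (intro exI[of _ "[]"]) auto
next
  case (step n)
  then obtain y where y: "x @ y \<in> L" "length (x @ y) = n" by auto
  then obtain v where "v \<in> L" "strict_prefix (x @ y) v"
    using assms(1) by (auto simp: pce_language_def)
  then obtain z' where "v = (x @ y) @ z'" "z' \<noteq> []"
    by (auto simp: strict_prefix_def prefix_def)
  then obtain c z where v: "v = (x @ y @ [c]) @ z"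
    by (cases z') auto
  with \<open>v \<in> L\<close> have "x @ y @ [c] \<in> L"
    using assms(1) unfolding pce_language_def by (metis prefixI)
  with y show ?case by (intro exI[of _ "y @ [c]"]) auto
qed

locale pce_numeration =
  fixes r :: nat and L :: "nat list set"
  assumes pce: "pce_language {..<r} L" and nonempty: "L \<noteq> {}"
begin

lemma words: "L \<subseteq> lists {..<r}"
  using pce by (auto simp: pce_language_def)

lemma take_mem: "w \<in> L \<Longrightarrow> take k w \<in> L"
  using pce unfolding pce_language_def by (meson take_is_prefix)

lemma Nil_mem: "[] \<in> L"
  using nonempty take_mem[of _ 0] by auto

lemmas extend = pce_extend[OF pce]

lemma num_words_pos: "num_words L n > 0"
  using extend[OF Nil_mem, of n] finite_words(1)[OF words, of n]
  by (auto simp: num_words_def card_gt_0_iff)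

lemma infinite: "infinite L"
proof
  assume "finite L"
  then obtain n where "\<forall>x\<in>L. length x < n"
    using finite_maxlen by auto
  moreover obtain y where "y \<in> L" "length y = n"
    using extend[OF Nil_mem, of n] by auto
  ultimately show False by blast
qed

lemmas enum_mem = radix_enum(1)[OF words infinite]
lemmas enum_rank = radix_enum(2)[OF words infinite]

lemma enum_less: "radix_enum L i \<sqsubset> radix_enum L (Suc i)"
proof -
  have "\<not> radix_enum L (Suc i) \<sqsubset> radix_enum L i"
    using radix_rank_strict_mono[OF words enum_mem, of "Suc i" "radix_enum L i"]
    unfolding enum_rank by linarith
  moreover have "radix_enum L (Suc i) \<noteq> radix_enum L i"
    using enum_rank n_not_Suc_n by metis
  ultimately show ?thesis using radix_less_total by blast
qed

lemma enum_consecutive: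
  assumes "v \<in> L" "radix_enum L i \<sqsubset> v" "v \<sqsubset> radix_enum L (Suc i)"
  shows False
  using radix_rank_strict_mono[OF words enum_mem assms(2)]
    radix_rank_strict_mono[OF words assms(1,3)] unfolding enum_rank by linarith

text \<open>Passing from the word of index \<open>N\<close> to its successor increases the right-hand side by the distance
  of the two words. If they have the same length, then for each \<open>k\<close> their prefixes of length \<open>k\<close> are
  equal or consecutive among the words of \<open>L\<close> of length \<open>k\<close>: a word of \<open>L\<close> between the prefixes could be
  prolonged to a word of \<open>L\<close> between the two words. If not, the first is the last word of its length \<open>n\<close>,
  the second is the first word of length \<open>n + 1\<close>, and all the ranks of prefixes are known.\<close>

lemma sum_cp_eq:
  "(\<Sum>i<N. cp L i) =
     (\<Sum>l<length (radix_enum L N). \<Sum>k\<le>l. num_words L k)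
     + (\<Sum>k\<le>length (radix_enum L N). lex_rank L (take k (radix_enum L N)))"
proof (induction N)
  case 0
  have "radix_rank L [] = 0" by (simp add: radix_rank_def radix_order_def)
  then have "radix_enum L 0 = []"
    by (intro inj_onD[OF radix_rank_inj[OF words]] enum_mem Nil_mem) (simp add: enum_rank)
  then show ?case by (simp add: lex_rank_def)
next
  case (Suc N)
  define w w' n where "w = radix_enum L N" and "w' = radix_enum L (Suc N)" and "n = length w"
  have mem: "w \<in> L" "w' \<in> L" and less: "w \<sqsubset> w'"
    and consec: "\<And>v. v \<in> L \<Longrightarrow> w \<sqsubset> v \<Longrightarrow> v \<sqsubset> w' \<Longrightarrow> False"
    unfolding w_def w'_def using enum_mem enum_less enum_consecutive by blast+
  note fin = finite_words(2)[OF words]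
  have fin_lex: "finite {x \<in> L. length x = k \<and> x \<sqsubset> v}" for k v
    by (rule finite_subset[OF _ fin[of v]]) auto
  let ?F = "\<lambda>w. (\<Sum>l<length w. \<Sum>k\<le>l. num_words L k) + (\<Sum>k\<le>length w. lex_rank L (take k w))"
  have "?F w' = ?F w + word_Delta w w'"
  proof (cases "length w' = n")
    case True
    have "lex_rank L (take k w') = lex_rank L (take k w) + of_bool (take k w \<noteq> take k w')"
      if k: "k \<le> n" for k
    proof (cases "take k w = take k w'")
      case False
      then have tless: "take k w \<sqsubset> take k w'"
        using take_radix_mono[OF less] True n_def by auto
      have "{x \<in> L. length x = k \<and> x \<sqsubset> take k w'}
            = insert (take k w) {x \<in> L. length x = k \<and> x \<sqsubset> take k w}" (is "?A = ?B")
      proof (intro equalityI subsetI)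
        fix x assume x: "x \<in> ?A"
        show "x \<in> ?B"
        proof (rule ccontr)
          assume "x \<notin> ?B"
          with x have "take k w \<sqsubset> x" using radix_less_total[of x "take k w"] by auto
          have "x \<in> L" "length x \<le> n" using x k by simp_all
          from extend[OF this] obtain y where "x @ y \<in> L" "length (x @ y) = n" by blast
          moreover have "take k (x @ y) = x" using x by auto
          ultimately have "w \<sqsubset> x @ y" "x @ y \<sqsubset> w'"
            using \<open>take k w \<sqsubset> x\<close> x True n_def
            by (metis radix_less_takeD, metis (no_types, lifting) mem_Collect_eq radix_less_takeD)
          then show False using consec \<open>x @ y \<in> L\<close> by blast
        qed
      next
        fix x assume "x \<in> ?B"
        then show "x \<in> ?A"
          using tless take_mem[OF mem(1)] k n_def radix_less_trans[OF _ tless] by auto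
      qed
      then show ?thesis
        using False k True n_def fin_lex by (simp add: lex_rank_def)
    qed simp
    then have "(\<Sum>k\<le>n. lex_rank L (take k w'))
               = (\<Sum>k\<le>n. lex_rank L (take k w)) + (\<Sum>k\<le>n. of_bool (take k w \<noteq> take k w'))"
      by (simp add: sum.distrib)
    also have "(\<Sum>k\<le>n. of_bool (take k w \<noteq> take k w') :: nat)
               = (\<Sum>k\<le>n. of_bool (length (longest_common_prefix w w') < k))"
      using take_eq_take_iff_lcp[of w w'] True n_def by (intro sum.cong) auto
    also have "\<dots> = card {k. k \<le> n \<and> length (longest_common_prefix w w') < k}"
      by (simp add: Int_def conj_commute)
    also have "{k. k \<le> n \<and> length (longest_common_prefix w w') < k}
                 = {length (longest_common_prefix w w')<..n}" by auto
    finally show ?thesis using True n_def by (simp add: word_Delta_def)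
  next
    case False
    then have "n < length w'" using radix_less_length[OF less] n_def by auto
    obtain y where "w @ y \<in> L" "length (w @ y) = Suc n"
      using extend[OF mem(1), of "Suc n"] n_def by auto
    then have "length w' \<le> Suc n"
      using consec[of "w @ y"] n_def radix_less_shorter[of w "w @ y"] radix_less_shorter[of "w @ y" w']
      by (metis lessI not_le_imp_less)
    with \<open>n < length w'\<close> have len: "length w' = Suc n" by simp
    \<comment> \<open>the prefixes of \<open>w'\<close> are the first, those of \<open>w\<close> the last words of their lengths\<close>
    have w': "lex_rank L (take k w') = 0" if "k \<le> Suc n" for k
    proof -
      have False if x: "x \<in> L" "length x = k" "x \<sqsubset> take k w'" for x
      proof -
        have "length x \<le> Suc n" using x \<open>k \<le> Suc n\<close> by simp
        from extend[OF x(1) this] obtain y where "x @ y \<in> L" "length (x @ y) = Suc n" by blast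
        moreover have "take k (x @ y) = x" using x by auto
        ultimately have "w \<sqsubset> x @ y" "x @ y \<sqsubset> w'"
          using x len n_def by (metis lessI radix_less_shorter, metis radix_less_takeD)
        then show False using consec \<open>x @ y \<in> L\<close> by blast
      qed
      then have none: "{x \<in> L. length x = k \<and> x \<sqsubset> take k w'} = {}" by blast
      have "length (take k w') = k" using len that by simp
      then show ?thesis unfolding lex_rank_def using none by (metis card.empty)
    qed
    have w: "Suc (lex_rank L (take k w)) = num_words L k" if k: "k \<le> n" for k
    proof -
      have "{x \<in> L. length x = k} = insert (take k w) {x \<in> L. length x = k \<and> x \<sqsubset> take k w}"
        (is "?A = ?B")
      proof (intro equalityI subsetI)
        fix x assume x: "x \<in> ?A"
        show "x \<in> ?B"
        proof (rule ccontr)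
          assume "x \<notin> ?B"
          with x have "take k w \<sqsubset> x" using radix_less_total[of x "take k w"] by auto
          have "x \<in> L" "length x \<le> n" using x k by simp_all
          from extend[OF this] obtain y where "x @ y \<in> L" "length (x @ y) = n" by blast
          moreover have "take k (x @ y) = x" using x by auto
          ultimately have "w \<sqsubset> x @ y" "x @ y \<sqsubset> w'"
            using \<open>take k w \<sqsubset> x\<close> len n_def
            by (metis radix_less_takeD, metis lessI radix_less_shorter)
          then show False using consec \<open>x @ y \<in> L\<close> by blast
        qed
      qed (use take_mem[OF mem(1)] k n_def in auto)
      then show ?thesis
        using k n_def fin_lex by (simp add: lex_rank_def num_words_def)
    qed
    have "(\<Sum>k\<le>n. num_words L k) = (\<Sum>k\<le>n. Suc (lex_rank L (take k w)))"
      using w by simp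
    also have "\<dots> = (\<Sum>k\<le>n. lex_rank L (take k w)) + Suc n"
      by (simp add: sum_Suc)
    finally show ?thesis
      using len w' n_def by (simp add: word_Delta_def)
  qed
  then show ?case
    using Suc by (simp add: cp_def w_def w'_def)
qed

lemma rank_eq: "N = (\<Sum>l<length (radix_enum L N). num_words L l) + lex_rank L (radix_enum L N)"
  using radix_rank_eq[OF words] enum_rank by metis

end

section \<open>Leaving a word through a smaller letter\<close>

lemma lex_rank_Nil [simp]: "lex_rank K [] = 0"
  by (simp add: lex_rank_def radix_order_def)

text \<open>A word below \<open>a # w\<close> either begins with a smaller letter, and then goes on arbitrarily, or
  begins with \<open>a\<close> and goes on below \<open>w\<close>.\<close>

lemma lex_rank_Cons:
  assumes K: "K \<subseteq> lists {..<r}"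
  shows "lex_rank K (a # w) =
           (\<Sum>b<a. num_words (quotient_language [b] K) (length w)) + lex_rank (quotient_language [a] K) w"
proof -
  let ?S = "\<lambda>b. {x \<in> quotient_language [b] K. length x = length w}"
  let ?T = "{x \<in> quotient_language [a] K. length x = length w \<and> x \<sqsubset> w}"
  have eq: "{x \<in> K. length x = length (a # w) \<and> x \<sqsubset> a # w} = (\<Union>b<a. (#) b ` ?S b) \<union> (#) a ` ?T"
    (is "?A = ?B")
  proof (intro equalityI subsetI)
    fix x assume x: "x \<in> ?A"
    then obtain b y where "x = b # y" by (cases x) auto
    with x show "x \<in> ?B" by (auto simp: quotient_language_def radix_less_Cons image_iff)
  qed (auto simp: quotient_language_def radix_less_Cons)
  have Q: "quotient_language [b] K \<subseteq> lists {..<r}" for b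
    using K by (auto simp: quotient_language_def)
  have fin: "finite (?S b)" "finite ?T" for b
    using finite_words(1)[OF Q] finite_subset[OF _ finite_words(2)[OF Q[of a], of w], of ?T] by auto
  have "lex_rank K (a # w) = card (\<Union>b<a. (#) b ` ?S b) + card ((#) a ` ?T)"
    unfolding lex_rank_def eq by (rule card_Un_disjoint) (use fin in auto)
  also have "card (\<Union>b<a. (#) b ` ?S b) = (\<Sum>b<a. card ((#) b ` ?S b))"
    by (rule card_UN_disjoint) (use fin in auto)
  finally show ?thesis by (simp add: card_image num_words_def lex_rank_def)
qed

text \<open>For a language whose numbers of words grow exactly like \<open>\<lambda>^m\<close>, the sum over \<open>k \<le> m\<close> is asymptotic to
  \<open>\<alpha> = \<lambda> / (\<lambda> - 1)\<close> times the last term; the defect measures the deviation from this.\<close>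

definition defect :: "real \<Rightarrow> 'a list set \<Rightarrow> nat \<Rightarrow> real" where
  "defect \<alpha> K m = (\<Sum>k\<le>m. real (num_words K k)) - \<alpha> * real (num_words K m)"

text \<open>Each letter of \<open>w\<close> contributes the defects of the quotients by the letters below it, evaluated at
  the length of what remains of \<open>w\<close>. Summing over all members of a set closed under quotients makes the
  bound independent of the quotients that actually occur along \<open>w\<close>.\<close>

lemma lex_rank_defect_bound:
  assumes "w \<in> lists {..<r}" "K \<in> \<Q>"
    and fin: "finite \<Q>" and words: "\<And>K. K \<in> \<Q> \<Longrightarrow> K \<subseteq> lists {..<r}"
    and closed: "\<And>K a. K \<in> \<Q> \<Longrightarrow> a < r \<Longrightarrow> quotient_language [a] K \<in> \<Q>"
  shows "\<bar>(\<Sum>k\<le>length w. real (lex_rank K (take k w))) - \<alpha> * real (lex_rank K w)\<bar>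
         \<le> real r * (\<Sum>m<length w. \<Sum>q\<in>\<Q>. \<bar>defect \<alpha> q m\<bar>)"
  using assms(1,2)
proof (induction w arbitrary: K rule: list.induct)
  case Nil
  then show ?case by simp
next
  case (Cons a w)
  define G where "G = (\<lambda>K w. (\<Sum>k\<le>length w. real (lex_rank K (take k w))) - \<alpha> * real (lex_rank K w))"
  let ?E = "\<lambda>m. \<Sum>q\<in>\<Q>. \<bar>defect \<alpha> q m\<bar>"
  let ?q = "\<lambda>b. quotient_language [b] K"
  have a: "a < r" and wr: "w \<in> lists {..<r}" using Cons.prems(1) by simp_all
  note rec = lex_rank_Cons[OF words[OF Cons.prems(2)]]
  have "(\<Sum>k\<le>Suc (length w). real (lex_rank K (take k (a # w))))
        = (\<Sum>k\<le>length w. real (lex_rank K (a # take k w)))"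
    by (simp only: sum.atMost_Suc_shift) simp
  also have "\<dots> = (\<Sum>k\<le>length w. (\<Sum>b<a. real (num_words (?q b) k)) + real (lex_rank (?q a) (take k w)))"
    by (intro sum.cong) (auto simp: rec)
  also have "\<dots> = (\<Sum>b<a. \<Sum>k\<le>length w. real (num_words (?q b) k))
                  + (\<Sum>k\<le>length w. real (lex_rank (?q a) (take k w)))"
    by (simp add: sum.distrib sum.swap[of _ "{..<a}"])
  finally have "G K (a # w) = (\<Sum>b<a. defect \<alpha> (?q b) (length w)) + G (?q a) w"
    by (simp add: G_def rec defect_def sum_subtractf sum_distrib_left algebra_simps)
  moreover have "\<bar>\<Sum>b<a. defect \<alpha> (?q b) (length w)\<bar> \<le> real r * ?E (length w)"
  proof -
    have "\<bar>\<Sum>b<a. defect \<alpha> (?q b) (length w)\<bar> \<le> (\<Sum>b<a. \<bar>defect \<alpha> (?q b) (length w)\<bar>)"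
      by (rule sum_abs)
    also have "\<dots> \<le> (\<Sum>b<a. ?E (length w))"
      by (intro sum_mono member_le_sum fin) (use closed Cons.prems(2) a in auto)
    also have "\<dots> \<le> real r * ?E (length w)"
      using a by (auto intro!: mult_right_mono sum_nonneg)
    finally show ?thesis .
  qed
  moreover have "\<bar>G (?q a) w\<bar> \<le> real r * (\<Sum>m<length w. ?E m)"
    unfolding G_def using Cons.IH[OF wr] closed[OF Cons.prems(2) a] by simp
  ultimately have "\<bar>G K (a # w)\<bar> \<le> real r * (\<Sum>m<Suc (length w). ?E m)"
    by (simp add: algebra_simps)
  then show ?case by (simp add: G_def)
qed

section \<open>Quotients of rational and pce languages\<close>

lemma run_append: "run E p (u @ v) q \<longleftrightarrow> (\<exists>s. run E p u s \<and> run E s v q)"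
proof (induction u arbitrary: p)
  case Nil
  show ?case using run.simps[of E p "[]"] by auto
next
  case (Cons a u)
  have step: "run E p (a # w) q \<longleftrightarrow> (\<exists>s. (p, a, s) \<in> E \<and> run E s w q)" for p w q
    using run.simps[of E p "a # w" q] by auto
  show ?case by (auto simp: step Cons.IH)
qed

lemma run_states:
  assumes "run E p w q" "p \<in> Q" "E \<subseteq> Q \<times> A \<times> Q"
  shows "q \<in> Q"
  using assms by induction auto

text \<open>A quotient by \<open>w\<close> depends only on the set of states that \<open>w\<close> reaches from the initial states.\<close>

lemma finite_quotients:
  assumes "rational_language A L"
  shows "finite (range (\<lambda>w. quotient_language w L))"
proof -
  obtain Q :: "nat set" and I T E where fin: "finite Q" and sub: "I \<subseteq> Q" "E \<subseteq> Q \<times> A \<times> Q"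
    and L: "L = {w. \<exists>p\<in>I. \<exists>q\<in>T. run E p w q}"
    using assms unfolding rational_language_def by blast
  have "quotient_language w L = {v. \<exists>s\<in>{s. \<exists>p\<in>I. run E p w s}. \<exists>q\<in>T. run E s v q}" for w
    by (auto simp: quotient_language_def L run_append)
  moreover have "{s. \<exists>p\<in>I. run E p w s} \<in> Pow Q" for w
    using run_states[OF _ _ sub(2)] sub(1) by auto
  ultimately have "range (\<lambda>w. quotient_language w L)
                     \<subseteq> (\<lambda>X. {v. \<exists>s\<in>X. \<exists>q\<in>T. run E s v q}) ` Pow Q"
    by blast
  with fin show ?thesis by (meson finite_Pow_iff finite_imageI finite_subset)
qed

lemma pce_quotient:
  assumes "pce_language A L"
  shows "pce_language A (quotient_language w L)"
  unfolding pce_language_def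
proof (intro conjI ballI allI impI)
  show "quotient_language w L \<subseteq> lists A"
    using assms by (auto simp: pce_language_def quotient_language_def subset_iff)
  fix v assume v: "v \<in> quotient_language w L"
  show "u \<in> quotient_language w L" if "prefix u v" for u
    using assms v that by (auto simp: pce_language_def quotient_language_def)
  obtain x where "x \<in> L" "strict_prefix (w @ v) x"
    using assms v by (auto simp: pce_language_def quotient_language_def)
  then show "\<exists>u\<in>quotient_language w L. strict_prefix v u"
    by (auto simp: quotient_language_def strict_prefix_def prefix_def)
qed

section \<open>Rational power series\<close>

text \<open>These are the power series of the rational functions without pole at the origin, a local ring
  whose units are the series with a nonzero constant term.\<close>

definition rational_fps :: "'a :: field fps \<Rightarrow> bool" where
  "rational_fps f \<longleftrightarrow> (\<exists>P Q. poly Q 0 \<noteq> 0 \<and> f * fps_of_poly Q = fps_of_poly P)"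

lemma rational_fps_const: "rational_fps (fps_const c)"
  unfolding rational_fps_def
  by (intro exI[of _ "[:c:]"] exI[of _ 1]) (simp add: fps_of_poly_const)

lemma rational_fps_X: "rational_fps fps_X"
  unfolding rational_fps_def
  by (intro exI[of _ "[:0, 1:]"] exI[of _ 1]) simp

lemma rational_fps_add:
  assumes "rational_fps f" "rational_fps g"
  shows "rational_fps (f + g)"
proof -
  obtain P Q P' Q' where "poly Q 0 \<noteq> 0" "f * fps_of_poly Q = fps_of_poly P"
      "poly Q' 0 \<noteq> 0" "g * fps_of_poly Q' = fps_of_poly P'"
    using assms unfolding rational_fps_def by blast
  moreover have "(f + g) * (fps_of_poly Q * fps_of_poly Q')
      = (f * fps_of_poly Q) * fps_of_poly Q' + (g * fps_of_poly Q') * fps_of_poly Q"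
    by (simp add: algebra_simps)
  ultimately show ?thesis
    unfolding rational_fps_def
    by (intro exI[of _ "P * Q' + P' * Q"] exI[of _ "Q * Q'"])
       (simp add: fps_of_poly_mult fps_of_poly_add)
qed

lemma rational_fps_mult:
  assumes "rational_fps f" "rational_fps g"
  shows "rational_fps (f * g)"
proof -
  obtain P Q P' Q' where "poly Q 0 \<noteq> 0" "f * fps_of_poly Q = fps_of_poly P"
      "poly Q' 0 \<noteq> 0" "g * fps_of_poly Q' = fps_of_poly P'"
    using assms unfolding rational_fps_def by blast
  moreover have "(f * g) * (fps_of_poly Q * fps_of_poly Q')
      = (f * fps_of_poly Q) * (g * fps_of_poly Q')"
    by (simp add: algebra_simps)
  ultimately show ?thesis
    unfolding rational_fps_def
    by (intro exI[of _ "P * P'"] exI[of _ "Q * Q'"]) (simp add: fps_of_poly_mult)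
qed

lemma rational_fps_uminus: "rational_fps f \<Longrightarrow> rational_fps (- f)"
  using rational_fps_mult[OF rational_fps_const[of "- 1"], of f] by (simp flip: fps_const_neg)

lemma rational_fps_sum: "(\<And>i. i \<in> I \<Longrightarrow> rational_fps (f i)) \<Longrightarrow> rational_fps (\<Sum>i\<in>I. f i)"
  using rational_fps_const[of 0]
  by (induction I rule: infinite_finite_induct) (auto intro: rational_fps_add)

lemma rational_fps_inverse:
  assumes "rational_fps f" "fps_nth f 0 \<noteq> 0"
  shows "rational_fps (inverse f)"
proof -
  obtain P Q where PQ: "poly Q 0 \<noteq> 0" "f * fps_of_poly Q = fps_of_poly P"
    using assms(1) unfolding rational_fps_def by blast
  have "fps_nth (f * fps_of_poly Q) 0 \<noteq> 0"
    using PQ(1) assms(2) by (simp add: poly_0_coeff_0)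
  then have "poly P 0 \<noteq> 0"
    unfolding PQ(2) by (simp add: poly_0_coeff_0)
  moreover have "inverse f * fps_of_poly P = fps_of_poly Q"
    unfolding PQ(2)[symmetric] using inverse_mult_eq_1[OF assms(2)] by (simp add: mult.assoc[symmetric])
  ultimately show ?thesis unfolding rational_fps_def by blast
qed

text \<open>Gaussian elimination: as the matrix has no constant terms, the coefficient \<open>1 - m k k\<close> of the unknown
  \<open>g k\<close> in its own equation is a unit, so the unknown can be eliminated; the matrix of the remaining
  system has no constant terms either.\<close>

lemma rational_fps_linear_system:
  fixes g :: "'i \<Rightarrow> 'a :: field fps"
  assumes "finite I"
    and "\<And>i. i \<in> I \<Longrightarrow> g i = c i + (\<Sum>j\<in>I. m i j * g j)"
    and "\<And>i. i \<in> I \<Longrightarrow> rational_fps (c i)"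
    and "\<And>i j. i \<in> I \<Longrightarrow> j \<in> I \<Longrightarrow> rational_fps (m i j)"
    and "\<And>i j. i \<in> I \<Longrightarrow> j \<in> I \<Longrightarrow> fps_nth (m i j) 0 = 0"
  shows "i \<in> I \<Longrightarrow> rational_fps (g i)"
  using assms
proof (induction I arbitrary: c m i rule: finite_induct)
  case empty
  then show ?case by simp
next
  case (insert k I)
  note eqn = insert.prems(2) and rat_c = insert.prems(3) and rat_m = insert.prems(4)
    and zero_m = insert.prems(5)
  define u where "u = inverse (1 - m k k)"
  have unit: "fps_nth (1 - m k k) 0 \<noteq> 0" using zero_m[of k k] by simp
  have "rational_fps (1 - m k k)"
    using rational_fps_add[OF rational_fps_const[of 1] rational_fps_uminus[OF rat_m[of k k]]] by simp
  then have rat_u: "rational_fps u" unfolding u_def using unit by (rule rational_fps_inverse)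
  have "g k * (1 - m k k) = c k + (\<Sum>j\<in>I. m k j * g j)"
    using eqn[of k] insert.hyps by (simp add: algebra_simps)
  then have "u * (g k * (1 - m k k)) = u * (c k + (\<Sum>j\<in>I. m k j * g j))" by simp
  also have "u * (g k * (1 - m k k)) = g k"
    using inverse_mult_eq_1[OF unit] by (simp add: u_def mult_ac)
  finally have gk: "g k = u * (c k + (\<Sum>j\<in>I. m k j * g j))" .
  \<comment> \<open>substituting this into the other equations gives a system without the unknown \<open>g k\<close>\<close>
  have rat_I: "rational_fps (g j)" if "j \<in> I" for j
  proof (rule insert.IH[of _ "\<lambda>i. c i + m i k * (u * c k)" "\<lambda>i j. m i j + m i k * (u * m k j)"])
    fix i assume i: "i \<in> I"
    have "g i = c i + m i k * g k + (\<Sum>j\<in>I. m i j * g j)"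
      using eqn[of i] i insert.hyps by (simp add: algebra_simps)
    also have "\<dots> = c i + m i k * (u * c k) + (\<Sum>j\<in>I. (m i j + m i k * (u * m k j)) * g j)"
      unfolding gk by (simp add: algebra_simps sum.distrib sum_distrib_left)
    finally show "g i = c i + m i k * (u * c k) + (\<Sum>j\<in>I. (m i j + m i k * (u * m k j)) * g j)" .
    show "rational_fps (c i + m i k * (u * c k))"
      using i by (intro rational_fps_add rational_fps_mult rat_u rat_c rat_m) auto
    fix j assume j: "j \<in> I"
    show "rational_fps (m i j + m i k * (u * m k j))"
      using i j by (intro rational_fps_add rational_fps_mult rat_u rat_m) auto
    show "fps_nth (m i j + m i k * (u * m k j)) 0 = 0"
      using i j zero_m by simp
  qed (use that in auto)
  have "rational_fps (g k)"
    unfolding gk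
    by (intro rational_fps_mult rational_fps_add rational_fps_sum rat_u rat_c rat_m rat_I) auto
  then show ?case using rat_I insert.prems(1) by auto
qed

section \<open>Generating functions of the quotients\<close>

lemma num_words_Suc:
  assumes K: "K \<subseteq> lists {..<r::nat}"
  shows "num_words K (Suc n) = (\<Sum>a<r. num_words (quotient_language [a] K) n)"
proof -
  have eq: "{w \<in> K. length w = Suc n} = (\<Union>a<r. (#) a ` {v \<in> quotient_language [a] K. length v = n})"
    (is "?A = ?B")
  proof (intro equalityI subsetI)
    fix w assume "w \<in> ?A"
    then obtain a v where "w = a # v" "a # v \<in> K" "length v = n"
      by (auto simp: length_Suc_conv)
    moreover from this have "a < r" using K by auto
    ultimately show "w \<in> ?B" by (auto simp: quotient_language_def)
  qed (auto simp: quotient_language_def)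
  have "quotient_language [a] K \<subseteq> lists {..<r}" for a
    using K by (auto simp: quotient_language_def)
  from finite_words(1)[OF this] have "finite {v \<in> quotient_language [a] K. length v = n}" for a .
  then show ?thesis
    unfolding num_words_def eq
    by (subst card_UN_disjoint) (auto simp: card_image)
qed

lemma gen_fun_quotients:
  assumes "K \<subseteq> lists {..<r::nat}"
  shows "gen_fun K = fps_const (of_nat (num_words K 0))
           + fps_X * (\<Sum>a<r. gen_fun (quotient_language [a] K))"
proof (rule fps_ext)
  fix n show "fps_nth (gen_fun K) n = fps_nth (fps_const (of_nat (num_words K 0))
           + fps_X * (\<Sum>a<r. gen_fun (quotient_language [a] K))) n"
    by (cases n) (simp_all add: gen_fun_def fps_sum_nth num_words_Suc[OF assms])
qed

text \<open>Sorting the words of a quotient by their first letter expresses its generating function linearly by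
  those of the finitely many quotients, with a factor \<open>X\<close> in front of each of them.\<close>

lemma rational_gen_fun:
  assumes rat: "rational_language {..<r::nat} L" and L: "L \<subseteq> lists {..<r}"
  shows "rational_fps (gen_fun (quotient_language w L))"
proof (rule rational_fps_linear_system[of "range (\<lambda>w. quotient_language w L)" gen_fun
      "\<lambda>K. fps_const (of_nat (num_words K 0))"
      "\<lambda>K K'. fps_X * fps_const (of_nat (card {a. a < r \<and> quotient_language [a] K = K'}))"])
  let ?\<Q> = "range (\<lambda>w. quotient_language w L)"
  show fin: "finite ?\<Q>" using rat by (rule finite_quotients)
  fix K assume "K \<in> ?\<Q>"
  then obtain w where K: "K = quotient_language w L" by blast
  have words: "K \<subseteq> lists {..<r}" using L by (auto simp: K quotient_language_def subset_iff)
  have "quotient_language [a] K = quotient_language (w @ [a]) L" for a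
    by (simp add: K quotient_language_def)
  then have closed: "quotient_language [a] K \<in> ?\<Q>" for a by simp
  have "(\<Sum>a<r. gen_fun (quotient_language [a] K))
        = (\<Sum>K'\<in>?\<Q>. \<Sum>a | a \<in> {..<r} \<and> quotient_language [a] K = K'. gen_fun (quotient_language [a] K))"
    by (rule sum.group[symmetric]) (use fin closed in \<open>auto simp del: image_subset_iff\<close>)
  also have "\<dots> = (\<Sum>K'\<in>?\<Q>. of_nat (card {a. a < r \<and> quotient_language [a] K = K'}) * gen_fun K')"
    by (intro sum.cong) auto
  finally show "gen_fun K = fps_const (of_nat (num_words K 0))
      + (\<Sum>K'\<in>?\<Q>. fps_X * fps_const (of_nat (card {a. a < r \<and> quotient_language [a] K = K'})) * gen_fun K')"
    by (subst gen_fun_quotients[OF words]) (simp add: sum_distrib_left mult.assoc fps_of_nat)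
qed (auto intro: rational_fps_const rational_fps_mult rational_fps_X)

text \<open>Reduce a fraction to lowest terms and divide the numerator with remainder.\<close>

lemma gen_fun_decomp_exists:
  assumes "rational_fps (gen_fun K)" and pos: "\<And>n. num_words K n > 0"
  shows "\<exists>T R S. gen_fun_decomp K T R S"
proof -
  obtain P Q where PQ: "poly Q 0 \<noteq> 0" "gen_fun K * fps_of_poly Q = fps_of_poly P"
    using assms(1) unfolding rational_fps_def by blast
  define d where "d = gcd P Q"
  obtain P' S where dec: "P = P' * d" "Q = S * d" and cop: "coprime P' S"
    using gcd_coprime_exists[of P Q] PQ(1) unfolding d_def by (metis gcd_eq_0_iff poly_0)
  have d: "d \<noteq> 0" and S0: "poly S 0 \<noteq> 0" using PQ(1) dec by auto
  have "gen_fun K * fps_of_poly S * fps_of_poly d = fps_of_poly P' * fps_of_poly d"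
    using PQ(2) unfolding dec by (simp add: fps_of_poly_mult mult_ac)
  then have eq: "gen_fun K * fps_of_poly S = fps_of_poly P'" using d by simp
  have unit: "fps_nth (fps_of_poly S) 0 \<noteq> 0" using S0 by (simp add: poly_0_coeff_0)
  define T R where "T = P' div S" and "R = P' mod S"
  have "gen_fun K = fps_of_poly P' / fps_of_poly S"
    using unit eq by (metis fps_of_poly_0 nonzero_mult_div_cancel_right fps_zero_nth)
  also have "P' = T * S + R" by (simp add: T_def R_def)
  also have "fps_of_poly (T * S + R) / fps_of_poly S = fps_of_poly T + fps_of_poly R / fps_of_poly S"
    using unit by (simp add: fps_of_poly_add fps_of_poly_mult fps_divide_unit distrib_right
        mult.assoc inverse_mult_eq_1')
  finally have gen: "gen_fun K = fps_of_poly T + fps_of_poly R / fps_of_poly S" .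
  \<comment> \<open>a constant denominator would make the generating function a polynomial\<close>
  have "degree S \<noteq> 0"
  proof
    assume "degree S = 0"
    then obtain s where s: "S = [:s:]" by (metis degree_eq_zeroE)
    have "s \<noteq> 0" using S0 s by simp
    have "fps_nth (gen_fun K * fps_of_poly S) (Suc (degree P')) = coeff P' (Suc (degree P'))"
      unfolding eq by simp
    then have "of_nat (num_words K (Suc (degree P'))) * s = 0"
      by (simp add: s fps_of_poly_const gen_fun_def coeff_eq_0)
    then show False using \<open>s \<noteq> 0\<close> pos[of "Suc (degree P')"] by simp
  qed
  moreover from this have "degree R < degree S"
    unfolding R_def by (cases "P' mod S = 0") (auto intro: degree_mod_less')
  moreover have "coprime R S"
    using cop S0 unfolding R_def by (subst coprime_mod_left_iff) auto
  ultimately show ?thesis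
    using gen S0 unfolding gen_fun_decomp_def by blast
qed

lemma of_rat_poly_add:
  "map_poly of_rat (p + q) = map_poly of_rat p + (map_poly of_rat q :: 'a :: field_char_0 poly)"
  by (rule poly_eqI) (simp add: coeff_map_poly of_rat_add)

lemma of_rat_poly_mult:
  "map_poly of_rat (p * q) = map_poly of_rat p * (map_poly of_rat q :: 'a :: field_char_0 poly)"
  by (rule poly_eqI) (simp add: coeff_map_poly coeff_mult of_rat_sum of_rat_mult)

lemma of_rat_poly_reflect:
  "map_poly of_rat (reflect_poly p) = reflect_poly (map_poly of_rat p :: 'a :: field_char_0 poly)"
  by (rule poly_eqI) (simp add: coeff_map_poly coeff_reflect_poly degree_map_poly)

lemma order_reflect_poly:
  fixes p :: "'a :: field poly"
  assumes "p \<noteq> 0" "a \<noteq> 0"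
  shows "order (inverse a) (reflect_poly p) = order a p"
proof -
  obtain q where p: "p = [:- a, 1:] ^ order a p * q" and q: "\<not> [:- a, 1:] dvd q"
    using order_decomp[OF assms(1)] by blast
  have "q \<noteq> 0" using q by auto
  have "poly q a \<noteq> 0" using q by (simp add: poly_eq_0_iff_dvd)
  then have rq: "poly (reflect_poly q) (inverse a) \<noteq> 0"
    using assms(2) by (simp add: poly_reflect_poly_nz)
  have "reflect_poly [:- a, 1:] = smult (- a) [:- inverse a, 1:]"
    using assms(2) by (simp add: reflect_poly_def)
  then have "reflect_poly p
      = smult ((- a) ^ order a p) ([:- inverse a, 1:] ^ order a p * reflect_poly q)"
    by (subst p) (simp only: reflect_poly_mult reflect_poly_power smult_power mult_smult_left)
  moreover have "[:- inverse a, 1:] ^ order a p * reflect_poly q \<noteq> 0" using \<open>q \<noteq> 0\<close> by simp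
  ultimately show ?thesis
    using assms(2) rq by (simp add: order_smult order_mult order_power_n_n order_0I)
qed

abbreviation word_series :: "'a list set \<Rightarrow> complex fps" where
  "word_series K \<equiv> Abs_fps (\<lambda>n. of_nat (num_words K n))"

text \<open>The decomposition of the generating function carried over to the complex numbers, in the form used
  below. A Bezout identity over the rationals shows that coprime numerator and denominator have no common
  complex root.\<close>

lemma eigen_poly_denominator:
  assumes "rational_fps (gen_fun K)" "\<And>n. num_words K n > 0"
  obtains S T R :: "complex poly"
  where "eigen_poly_complex K = reflect_poly S" "poly S 0 \<noteq> 0" "degree S > 0"
    "\<And>z. poly S z = 0 \<Longrightarrow> poly R z \<noteq> 0"
    "word_series K = fps_of_poly T + fps_of_poly R / fps_of_poly S"
proof -
  define S where "S = (SOME S. \<exists>T R. gen_fun_decomp K T R S)"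
  have "\<exists>T R. gen_fun_decomp K T R S"
    unfolding S_def using gen_fun_decomp_exists[OF assms] by (metis (mono_tags, lifting) someI_ex)
  then obtain T R where gen: "gen_fun K = fps_of_poly T + fps_of_poly R / fps_of_poly S"
    and cop: "coprime R S" and deg: "degree R < degree S" and S0: "poly S 0 \<noteq> 0"
    unfolding gen_fun_decomp_def by blast
  let ?c = "map_poly of_rat :: rat poly \<Rightarrow> complex poly"
  have unit: "fps_nth (fps_of_poly S) 0 \<noteq> 0" "fps_nth (fps_of_poly (?c S)) 0 \<noteq> 0"
    using S0 by (simp_all add: poly_0_coeff_0 coeff_map_poly)
  have "gen_fun K * fps_of_poly S = fps_of_poly (T * S + R)"
    unfolding gen fps_divide_unit[OF unit(1)]
    using inverse_mult_eq_1[OF unit(1)] by (simp add: fps_of_poly_add fps_of_poly_mult algebra_simps)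
  then have coeffs: "(\<Sum>i=0..n. of_nat (num_words K i) * coeff S (n - i)) = coeff (T * S + R) n" for n
    unfolding fps_eq_iff by (simp add: fps_mult_nth gen_fun_def)
  have "word_series K * fps_of_poly (?c S) = fps_of_poly (?c (T * S + R))"
  proof (rule fps_ext)
    fix n
    have "(\<Sum>i=0..n. of_nat (num_words K i) * of_rat (coeff S (n - i)) :: complex)
          = of_rat (\<Sum>i=0..n. of_nat (num_words K i) * coeff S (n - i))"
      by (simp add: of_rat_sum of_rat_mult)
    then show "fps_nth (word_series K * fps_of_poly (?c S)) n = fps_nth (fps_of_poly (?c (T * S + R))) n"
      unfolding coeffs by (simp add: fps_mult_nth coeff_map_poly)
  qed
  then have "word_series K * fps_of_poly (?c S) * inverse (fps_of_poly (?c S))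
     = (fps_of_poly (?c T) * fps_of_poly (?c S) + fps_of_poly (?c R)) * inverse (fps_of_poly (?c S))"
    by (simp add: of_rat_poly_add of_rat_poly_mult fps_of_poly_add fps_of_poly_mult)
  then have "word_series K = fps_of_poly (?c T) + fps_of_poly (?c R) / fps_of_poly (?c S)"
    using inverse_mult_eq_1'[OF unit(2)] fps_divide_unit[OF unit(2)]
    by (simp add: mult.assoc distrib_right)
  moreover have "eigen_poly_complex K = reflect_poly (?c S)"
    by (simp add: eigen_poly_complex_def eigen_poly_def S_def of_rat_poly_reflect)
  moreover have "poly (?c R) z \<noteq> 0" if z: "poly (?c S) z = 0" for z
  proof -
    have "fst (bezout_coefficients R S) * R + snd (bezout_coefficients R S) * S = 1"
      using cop bezout_coefficients_fst_snd[of R S] by simp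
    then obtain a b where "a * R + b * S = 1" by blast
    then have "?c (a * R + b * S) = 1" by (simp add: map_poly_1)
    then have "poly (?c a * ?c R + ?c b * ?c S) z = poly 1 z"
      unfolding of_rat_poly_add of_rat_poly_mult by (rule arg_cong)
    then show ?thesis using z by auto
  qed
  moreover have "poly (?c S) 0 \<noteq> 0" using unit(2) by (simp add: poly_0_coeff_0)
  moreover have "degree (?c S) > 0" using deg by (simp add: degree_map_poly)
  ultimately show thesis using that by blast
qed

section \<open>Coefficients of rational functions\<close>

text \<open>The constant absorbs the finitely many terms that are not yet small, so that the
  estimate holds for every \<open>n\<close>.\<close>

lemma sum_smallo_bound:
  fixes E u :: "nat \<Rightarrow> real"
  assumes o: "E \<in> o(u)" and u: "\<And>n. u n \<ge> 0" and eps: "\<epsilon> > 0"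
  shows "\<exists>C\<ge>0. \<forall>n. (\<Sum>m<n. \<bar>E m\<bar>) \<le> C + \<epsilon> * (\<Sum>m<n. u m)"
proof -
  obtain N where N: "\<bar>E m\<bar> \<le> \<epsilon> * u m" if "m \<ge> N" for m
    using landau_o.smallD[OF o eps] u by (auto simp: eventually_sequentially)
  have "(\<Sum>m<n. \<bar>E m\<bar>) \<le> (\<Sum>m<N. \<bar>E m\<bar>) + \<epsilon> * (\<Sum>m<n. u m)" for n
  proof -
    have "(\<Sum>m<n. \<bar>E m\<bar>) \<le> (\<Sum>m<n. (if m < N then \<bar>E m\<bar> else 0) + \<epsilon> * u m)"
      using N u eps by (intro sum_mono) (auto simp: not_less)
    also have "\<dots> = (\<Sum>m | m < n \<and> m < N. \<bar>E m\<bar>) + \<epsilon> * (\<Sum>m<n. u m)"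
      by (simp add: sum.distrib sum_distrib_left sum.If_cases Int_def)
    also have "(\<Sum>m | m < n \<and> m < N. \<bar>E m\<bar>) \<le> (\<Sum>m<N. \<bar>E m\<bar>)"
      by (intro sum_mono2) auto
    finally show ?thesis by simp
  qed
  then show ?thesis by (intro exI[of _ "\<Sum>m<N. \<bar>E m\<bar>"]) (simp add: sum_nonneg)
qed

lemma sum_smallo:
  fixes E u w :: "nat \<Rightarrow> real"
  assumes o: "E \<in> o(u)" and u: "\<And>n. u n \<ge> 0"
    and V: "(\<lambda>n. \<Sum>m<n. u m) \<in> O(w)" and w: "(\<lambda>_. 1) \<in> o(w)"
  shows "(\<lambda>n. \<Sum>m<n. \<bar>E m\<bar>) \<in> o(w)"
proof (rule landau_o.smallI)
  fix c :: real assume c: "c > 0"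
  obtain B where B: "B > 0" "eventually (\<lambda>n. norm (\<Sum>m<n. u m) \<le> B * norm (w n)) sequentially"
    using V by (rule landau_o.bigE)
  have "c / (2 * B) > 0" using c B by simp
  from sum_smallo_bound[OF o u this]
  obtain C where C: "C \<ge> 0" "\<And>n. (\<Sum>m<n. \<bar>E m\<bar>) \<le> C + c / (2 * B) * (\<Sum>m<n. u m)" by auto
  have "(\<lambda>_. C) \<in> o(w)" using landau_o.big_small_trans[OF _ w, of "\<lambda>_. C"] by simp
  then have "eventually (\<lambda>n. norm C \<le> c / 2 * norm (w n)) sequentially"
    by (rule landau_o.smallD) (use c in simp)
  with B(2) show "eventually (\<lambda>n. norm (\<Sum>m<n. \<bar>E m\<bar>) \<le> c * norm (w n)) sequentially"
  proof eventually_elim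
    case (elim n)
    have "c / (2 * B) * (\<Sum>m<n. u m) \<le> c / (2 * B) * (B * norm (w n))"
      using elim(1) c B(1) by (intro mult_left_mono) auto
    also have "\<dots> = c / 2 * norm (w n)" using B(1) by simp
    finally have "C + c / (2 * B) * (\<Sum>m<n. u m) \<le> c / 2 * norm (w n) + c / 2 * norm (w n)"
      using elim(2) by (intro add_mono) auto
    also have "\<dots> = c * norm (w n)" by simp
    finally have "(\<Sum>m<n. \<bar>E m\<bar>) \<le> c * norm (w n)" using C(2)[of n] by (rule order_trans[rotated])
    then show ?case by (simp add: sum_nonneg)
  qed
qed

lemma sum_smallo_power:
  fixes E :: "nat \<Rightarrow> real"
  assumes E: "E \<in> o(\<lambda>n. real n ^ k)"
  shows "(\<lambda>n. \<Sum>m\<le>n. \<bar>E m\<bar>) \<in> o(\<lambda>n. real n ^ Suc k)"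
proof -
  have "(\<lambda>n. \<Sum>m<n. \<bar>E m\<bar>) \<in> o(\<lambda>n. real n ^ Suc k)"
  proof (rule sum_smallo[OF E])
    have "norm (\<Sum>m<n. real m ^ k) \<le> 1 * norm (real n ^ Suc k)" for n
    proof -
      have "(\<Sum>m<n. real m ^ k) \<le> (\<Sum>m<n. real n ^ k)" by (intro sum_mono power_mono) auto
      then show ?thesis by (simp add: sum_nonneg)
    qed
    then show "(\<lambda>n. \<Sum>m<n. real m ^ k) \<in> O(\<lambda>n. real n ^ Suc k)"
      by (intro landau_o.bigI[of 1] always_eventually allI) simp_all
    show "(\<lambda>_. 1) \<in> o(\<lambda>n. real n ^ Suc k)" by real_asymp
  qed simp
  moreover have "(\<lambda>n. real n ^ k) \<in> O(\<lambda>n. real n ^ Suc k)"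
  proof (rule landau_o.bigI[of 1])
    show "eventually (\<lambda>n. norm (real n ^ k) \<le> 1 * norm (real n ^ Suc k)) sequentially"
      using eventually_gt_at_top[of 0] by eventually_elim (simp add: mult_le_cancel_right1)
  qed simp
  from landau_o.small_big_trans[OF E this] have "(\<lambda>n. \<bar>E n\<bar>) \<in> o(\<lambda>n. real n ^ Suc k)" by simp
  ultimately have "(\<lambda>n. (\<Sum>m<n. \<bar>E m\<bar>) + \<bar>E n\<bar>) \<in> o(\<lambda>n. real n ^ Suc k)"
    by (rule sum_in_smallo(1))
  moreover have "(\<Sum>m\<le>n. \<bar>E m\<bar>) = (\<Sum>m<n. \<bar>E m\<bar>) + \<bar>E n\<bar>" for n
    by (metis lessThan_Suc_atMost sum.lessThan_Suc)
  ultimately show ?thesis by simp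
qed

lemma fps_of_poly_root: "fps_of_poly [:- a, 1:] = fps_X - fps_const (a :: 'a :: field)"
  using fps_of_poly_linear[of "- a"] by simp

text \<open>Dividing by \<open>X - z\<close> amounts to summing the coefficients, normalised by the powers of \<open>z\<close>; this
  costs one power of \<open>n\<close>.\<close>

lemma smallo_divide_linear:
  fixes B :: "complex fps"
  assumes z: "cmod z = s" "s > 0"
    and o: "(\<lambda>n. cmod (fps_nth (B * fps_of_poly [:- z, 1:]) n) * s ^ n) \<in> o(\<lambda>n. real n ^ k)"
  shows "(\<lambda>n. cmod (fps_nth B n) * s ^ n) \<in> o(\<lambda>n. real n ^ Suc k)"
proof -
  define A where "A = B * fps_of_poly [:- z, 1:]"
  define \<alpha> where "\<alpha> = (\<lambda>n. cmod (fps_nth A n) * s ^ n)"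
  have A: "A = fps_X * B - fps_const z * B"
    by (simp add: A_def fps_of_poly_root algebra_simps)
  have A0: "fps_nth A 0 = - z * fps_nth B 0"
    and AS: "fps_nth A (Suc n) = fps_nth B n - z * fps_nth B (Suc n)" for n
    by (simp_all add: A)
  have bound: "cmod (fps_nth B n) * s ^ n \<le> (\<Sum>m\<le>n. \<bar>\<alpha> m\<bar>) / s" for n
  proof (induction n)
    case 0
    have "\<alpha> 0 = s * cmod (fps_nth B 0)" using z by (simp add: \<alpha>_def A0 norm_mult)
    then show ?case using z by simp
  next
    case (Suc n)
    have "s * cmod (fps_nth B (Suc n)) = cmod (fps_nth B n - fps_nth A (Suc n))"
      using z by (simp add: AS norm_mult)
    also have "\<dots> \<le> cmod (fps_nth B n) + cmod (fps_nth A (Suc n))"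
      by (rule norm_triangle_ineq4)
    finally have "s * cmod (fps_nth B (Suc n)) * s ^ n
        \<le> (cmod (fps_nth B n) + cmod (fps_nth A (Suc n))) * s ^ n"
      using z by (intro mult_right_mono) auto
    then have "cmod (fps_nth B (Suc n)) * s ^ Suc n \<le> cmod (fps_nth B n) * s ^ n + \<alpha> (Suc n) / s"
      using z by (simp add: \<alpha>_def field_simps)
    also have "\<dots> \<le> (\<Sum>m\<le>Suc n. \<bar>\<alpha> m\<bar>) / s"
    proof -
      have "\<alpha> (Suc n) / s = \<bar>\<alpha> (Suc n)\<bar> / s" using z by (simp add: \<alpha>_def)
      then show ?thesis using Suc.IH by (simp only: sum.atMost_Suc add_divide_distrib)
    qed
    finally show ?case .
  qed
  have "(\<lambda>n. \<Sum>m\<le>n. \<bar>\<alpha> m\<bar>) \<in> o(\<lambda>n. real n ^ Suc k)"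
    using o unfolding \<alpha>_def A_def by (rule sum_smallo_power)
  then have "(\<lambda>n. (\<Sum>m\<le>n. \<bar>\<alpha> m\<bar>) / s) \<in> o(\<lambda>n. real n ^ Suc k)"
    using z by simp
  moreover have "(\<lambda>n. cmod (fps_nth B n) * s ^ n) \<in> O(\<lambda>n. (\<Sum>m\<le>n. \<bar>\<alpha> m\<bar>) / s)"
  proof (rule landau_o.bigI[of 1])
    show "eventually (\<lambda>n. norm (cmod (fps_nth B n) * s ^ n) \<le> 1 * norm ((\<Sum>m\<le>n. \<bar>\<alpha> m\<bar>) / s)) sequentially"
      using bound z by (intro always_eventually) (simp add: sum_nonneg)
  qed simp
  ultimately show ?thesis by (rule landau_o.big_small_trans[rotated])
qed

text \<open>The radius of convergence exceeds \<open>s\<close>, because the finitely many poles keep a distance from the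
  closed disc.\<close>

lemma rational_coeff_tendsto_0:
  fixes R S :: "complex poly"
  assumes s: "s > 0" and roots: "\<And>z. poly S z = 0 \<Longrightarrow> s < cmod z"
  shows "(\<lambda>n. cmod (fps_nth (fps_of_poly R / fps_of_poly S) n) * s ^ n) \<longlonglongrightarrow> 0"
proof -
  have "poly S 0 \<noteq> 0" using roots[of 0] s by auto
  then have "S \<noteq> 0" by auto
  then have fin: "finite {z. poly S z = 0}" by (rule poly_roots_finite)
  obtain \<rho> where \<rho>: "s < \<rho>" "\<And>z :: complex. poly S z = 0 \<Longrightarrow> \<rho> \<le> cmod z"
  proof (cases "{z. poly S z = 0} = {}")
    case True
    then show thesis using that[of "s + 1"] by auto
  next
    case False
    then show thesis using that[of "Min (cmod ` {z. poly S z = 0})"] fin roots by auto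
  qed
  let ?F = "fps_of_poly R / fps_of_poly S"
  have "Min {ereal \<rho>, fps_conv_radius (fps_of_poly R), fps_conv_radius (fps_of_poly S)} \<le> fps_conv_radius ?F"
  proof (rule fps_conv_radius_divide')
    fix z :: complex assume "z \<in> eball 0 (ereal \<rho>)"
    then have "cmod z < \<rho>" by (simp add: in_eball_iff)
    then show "eval_fps (fps_of_poly S) z \<noteq> 0" using \<rho>(2)[of z] by auto
  qed (use \<rho>(1) s in auto)
  then have "ereal (norm (complex_of_real s)) < fps_conv_radius ?F"
    using \<rho>(1) s less_le_trans[of "ereal s" "ereal \<rho>" "fps_conv_radius ?F"] by simp
  from tendsto_norm_zero[OF summable_LIMSEQ_zero[OF summable_fps[OF this]]]
  show ?thesis using s by (simp add: norm_mult norm_power)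
qed

text \<open>Partial fractions in the weakest form that suffices. The induction removes roots on the circle of
  radius \<open>s\<close>: two distinct ones are separated into two fractions with smaller denominators, and a single
  one is divided out at the price of one power of \<open>n\<close>. With no root left on the circle, the
  normalised coefficients tend to \<open>0\<close>.\<close>

lemma rational_coeff_smallo:
  fixes R S :: "complex poly"
  assumes s: "s > 0" and "\<And>z. poly S z = 0 \<Longrightarrow> s \<le> cmod z"
    and "\<And>z. cmod z = s \<Longrightarrow> order z S \<le> k"
  shows "(\<lambda>n. cmod (fps_nth (fps_of_poly R / fps_of_poly S) n) * s ^ n) \<in> o(\<lambda>n. real n ^ k)"
  using assms(2,3)
proof (induction "degree S" arbitrary: S k rule: less_induct)
  case less
  note roots = less.prems(1) and orders = less.prems(2)
  have S0: "poly S 0 \<noteq> 0" using roots[of 0] s by auto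
  then have "S \<noteq> 0" by auto
  define F where "F S = fps_of_poly R / fps_of_poly S" for S
  have F: "F S' = fps_of_poly R * inverse (fps_of_poly S')" if "poly S' 0 \<noteq> 0" for S'
    unfolding F_def by (rule fps_divide_unit) (use that in \<open>simp add: poly_0_coeff_0\<close>)
  \<comment> \<open>a root on the critical circle can be split off, leaving a polynomial of smaller degree\<close>
  have split: "poly S' 0 \<noteq> 0" "degree S' < degree S" "F S * fps_of_poly [:- x, 1:] = F S'"
      "\<And>z. poly S' z = 0 \<Longrightarrow> s \<le> cmod z" "\<And>z. order z S = order z [:- x, 1:] + order z S'"
      "\<And>z. cmod z = s \<Longrightarrow> order z S' \<le> k"
    if S: "S = [:- x, 1:] * S'" for x S'
  proof -
    show "poly S' 0 \<noteq> 0" using S0 S by auto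
    have "S' \<noteq> 0" using S0 S by auto
    show "degree S' < degree S" unfolding S using \<open>S' \<noteq> 0\<close> by (subst degree_mult_eq) auto
    show "s \<le> cmod z" if "poly S' z = 0" for z using roots[of z] that S by auto
    show order: "order z S = order z [:- x, 1:] + order z S'" for z
      unfolding S using \<open>S \<noteq> 0\<close> S by (intro order_mult) auto
    show "order z S' \<le> k" if "cmod z = s" for z
      using orders[OF that] order[of z] by simp
    have "x \<noteq> 0" using S0 S by auto
    then have "inverse (fps_of_poly [:- x, 1:]) * fps_of_poly [:- x, 1:] = 1"
      by (intro inverse_mult_eq_1) simp
    then show "F S * fps_of_poly [:- x, 1:] = F S'"
      unfolding F[OF S0] F[OF \<open>poly S' 0 \<noteq> 0\<close>] unfolding S fps_of_poly_mult fps_inverse_mult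
      by (simp add: mult_ac)
  qed
  show ?case
  proof (cases "\<exists>x. cmod x = s \<and> poly S x = 0")
    case False
    have "(\<lambda>n. cmod (fps_nth (F S) n) * s ^ n) \<longlonglongrightarrow> 0"
      unfolding F_def using False roots by (intro rational_coeff_tendsto_0 s) (force simp: le_less)
    then have "(\<lambda>n. cmod (fps_nth (F S) n) * s ^ n) \<in> o(\<lambda>_. 1)"
      by (intro smalloI_tendsto) auto
    also have "(\<lambda>_. 1) \<in> O(\<lambda>n. real n ^ k)"
    proof (rule landau_o.bigI[of 1])
      show "eventually (\<lambda>n. norm (1 :: real) \<le> 1 * norm (real n ^ k)) sequentially"
        using eventually_gt_at_top[of 0] by eventually_elim (auto intro: one_le_power)
    qed simp
    finally show ?thesis unfolding F_def .
  next
    case True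
    then obtain x where x: "cmod x = s" "poly S x = 0" by blast
    then obtain Sx where Sx: "S = [:- x, 1:] * Sx" by (auto simp: poly_eq_0_iff_dvd dvd_def)
    note sx = split[OF Sx]
    show ?thesis
    proof (cases "\<exists>y. y \<noteq> x \<and> cmod y = s \<and> poly S y = 0")
      case True
      \<comment> \<open>\<open>1 / ((X - x) (X - y)) = (1 / (X - x) - 1 / (X - y)) / (x - y)\<close> reduces to the
        two denominators that lack one of the factors\<close>
      then obtain y where y: "y \<noteq> x" "cmod y = s" "poly S y = 0" by blast
      then obtain Sy where Sy: "S = [:- y, 1:] * Sy" by (auto simp: poly_eq_0_iff_dvd dvd_def)
      note sy = split[OF Sy]
      have "(\<lambda>n. cmod (fps_nth (F Sx) n) * s ^ n) \<in> o(\<lambda>n. real n ^ k)"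
        unfolding F_def by (intro less.hyps sx)
      moreover have "(\<lambda>n. cmod (fps_nth (F Sy) n) * s ^ n) \<in> o(\<lambda>n. real n ^ k)"
        unfolding F_def by (intro less.hyps sy)
      ultimately have "(\<lambda>n. cmod (fps_nth (F Sx) n) * s ^ n + cmod (fps_nth (F Sy) n) * s ^ n)
          \<in> o(\<lambda>n. real n ^ k)"
        by (rule sum_in_smallo(1))
      moreover have "(\<lambda>n. cmod (fps_nth (F S) n) * s ^ n)
          \<in> O(\<lambda>n. cmod (fps_nth (F Sx) n) * s ^ n + cmod (fps_nth (F Sy) n) * s ^ n)"
      proof (rule landau_o.bigI[of "1 / cmod (y - x)"])
        show "0 < 1 / cmod (y - x)" using y(1) by simp
        have "fps_const (y - x) * F S = F Sx - F Sy"
          unfolding sx(3)[symmetric] sy(3)[symmetric]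
          by (simp add: fps_of_poly_root ring_distribs mult.commute[of "F S"] flip: fps_const_sub)
        then have "(y - x) * fps_nth (F S) n = fps_nth (F Sx) n - fps_nth (F Sy) n" for n
          by (metis fps_mult_left_const_nth fps_sub_nth)
        then have "cmod (y - x) * cmod (fps_nth (F S) n) \<le> cmod (fps_nth (F Sx) n) + cmod (fps_nth (F Sy) n)" for n
          by (metis norm_mult norm_triangle_ineq4)
        then have "cmod (fps_nth (F S) n) * s ^ n
            \<le> (cmod (fps_nth (F Sx) n) + cmod (fps_nth (F Sy) n)) / cmod (y - x) * s ^ n" for n
          using s y(1) by (intro mult_right_mono) (simp_all add: field_simps)
        then show "eventually (\<lambda>n. norm (cmod (fps_nth (F S) n) * s ^ n) \<le> 1 / cmod (y - x) *
            norm (cmod (fps_nth (F Sx) n) * s ^ n + cmod (fps_nth (F Sy) n) * s ^ n)) sequentially"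
          using s by (intro always_eventually) (simp add: distrib_right add_divide_distrib)
      qed
      ultimately show ?thesis unfolding F_def[symmetric] by (rule landau_o.big_small_trans[rotated])
    next
      case False
      have ordx: "order x S = Suc (order x Sx)"
        using sx(5)[of x] order_power_n_n[of x 1] by simp
      then obtain k' where k: "k = Suc k'" using orders[OF x(1)] by (cases k) auto
      have "(\<lambda>n. cmod (fps_nth (F Sx) n) * s ^ n) \<in> o(\<lambda>n. real n ^ k')"
        unfolding F_def
      proof (intro less.hyps sx)
        fix z assume z: "cmod z = s"
        show "order z Sx \<le> k'"
        proof (cases "z = x")
          case True
          then show ?thesis using orders[OF x(1)] ordx k by simp
        next
          case notx: False
          then have "poly S z \<noteq> 0" using False z by blast
          then show ?thesis using sx(5)[of z] order_0I by fastforce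
        qed
      qed
      then show ?thesis
        unfolding F_def[symmetric] sx(3)[symmetric] k by (intro smallo_divide_linear[OF x(1) s])
    qed
  qed
qed

lemma binomial_power_limit:
  "(\<lambda>n. real ((n + e) choose e) / real n ^ e) \<longlonglongrightarrow> 1 / fact e"
proof (induction e)
  case 0
  show ?case by simp
next
  case (Suc e)
  have "(\<lambda>n. (real n + real e + 1) / real n) \<longlonglongrightarrow> 1" by real_asymp
  then have "(\<lambda>n. real ((n + e) choose e) / real n ^ e * ((real n + real e + 1) / real n) / real (Suc e))
      \<longlonglongrightarrow> 1 / fact e * 1 / real (Suc e)"
    by (intro tendsto_intros Suc.IH) auto
  moreover have "real ((n + e) choose e) / real n ^ e * ((real n + real e + 1) / real n) / real (Suc e)
      = real ((n + Suc e) choose Suc e) / real n ^ Suc e" for n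
  proof -
    have "Suc e * (Suc (n + e) choose Suc e) = Suc (n + e) * ((n + e) choose e)"
      by (rule Suc_times_binomial)
    then have "real (Suc e) * real (Suc (n + e) choose Suc e) = real (Suc (n + e)) * real ((n + e) choose e)"
      by (metis of_nat_mult)
    then have "real (Suc (n + e) choose Suc e) = real (Suc (n + e)) * real ((n + e) choose e) / real (Suc e)"
      by (simp add: nonzero_eq_divide_eq mult.commute)
    then show ?thesis by (simp add: mult_ac add_ac)
  qed
  ultimately show ?case by (simp add: mult.commute)
qed

lemma fps_nth_inverse_root_power:
  fixes a :: complex
  assumes "a \<noteq> 0"
  shows "fps_nth (inverse (fps_of_poly [:- a, 1:] ^ Suc e)) n
           = (- 1 / a) ^ Suc e * of_nat ((n + e) choose e) / a ^ n"
proof -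
  have "fps_of_poly [:- a, 1:] = fps_const (- a) * (1 - fps_const (1 / a) * fps_X)"
    using assms by (intro fps_ext) (auto simp: fps_of_poly_root fps_X_def)
  then have "inverse (fps_of_poly [:- a, 1:] ^ Suc e)
      = fps_const ((- 1 / a) ^ Suc e) * inverse ((1 - fps_const (1 / a) * fps_X) ^ Suc e)"
    using power_inverse[of "- a" "Suc e"]
    by (simp only: power_mult_distrib fps_inverse_mult fps_const_power fps_const_inverse)
       (auto simp: divide_inverse)
  also have "inverse ((1 - fps_const (1 / a) * fps_X) ^ Suc e)
      = Abs_fps (\<lambda>k. of_nat ((Suc e + k - 1) choose k) * (1 / a) ^ k)"
    by (rule one_minus_const_fps_X_neg_power') simp
  finally show ?thesis
    using binomial_symmetric[of n "n + e"] by (simp add: power_divide add.commute)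
qed

text \<open>Splitting off \<open>c / (X - s)^d\<close> with \<open>c \<noteq> 0\<close>, where \<open>d\<close> is the order of the pole at \<open>s\<close>, leaves poles of
  order less than \<open>d\<close> on the circle. The coefficients of the fraction split off are explicit and of exact
  order \<open>n^(d - 1) / s^n\<close>, whereas the remaining ones are negligible, so consecutive
  coefficients have the quotient \<open>1 / s\<close> in the limit.\<close>

lemma dominant_pole_ratio:
  fixes u :: "nat \<Rightarrow> nat" and T R S :: "complex poly"
  assumes u: "Abs_fps (\<lambda>n. of_nat (u n)) = fps_of_poly T + fps_of_poly R / fps_of_poly S"
    and s: "s > 0" and roots: "\<And>z. poly S z = 0 \<Longrightarrow> s \<le> cmod z"
    and root: "poly S (of_real s) = 0" and R: "poly R (of_real s) \<noteq> 0"
    and dominant: "\<And>z. cmod z = s \<Longrightarrow> z \<noteq> of_real s \<Longrightarrow> order z S < order (of_real s) S"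
  shows "(\<lambda>n. real (u (Suc n)) / real (u n)) \<longlonglongrightarrow> 1 / s"
proof -
  define a :: complex where "a = of_real s"
  have a: "a \<noteq> 0" "cmod a = s" using s by (auto simp: a_def)
  have S0: "poly S 0 \<noteq> 0" using roots[of 0] s by auto
  then have "S \<noteq> 0" by auto
  then have "order a S \<noteq> 0" using root by (simp add: order_root a_def)
  then obtain e where e: "order a S = Suc e" by (cases "order a S") auto
  obtain S1 where S: "S = [:- a, 1:] ^ Suc e * S1" and "\<not> [:- a, 1:] dvd S1"
    using order_decomp[OF \<open>S \<noteq> 0\<close>, of a] e by auto
  then have S1a: "poly S1 a \<noteq> 0" by (simp add: poly_eq_0_iff_dvd)
  \<comment> \<open>the value for which \<open>R - c * S1\<close> is divisible by \<open>X - a\<close>\<close>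
  define c where "c = poly R a / poly S1 a"
  have c: "c \<noteq> 0" using R S1a by (simp add: c_def a_def)
  have "poly (R - smult c S1) a = 0" using S1a by (simp add: c_def)
  then have "[:- a, 1:] dvd R - smult c S1" by (simp only: poly_eq_0_iff_dvd)
  then obtain R' where "R - smult c S1 = [:- a, 1:] * R'" by (rule dvdE)
  then have R': "R = smult c S1 + [:- a, 1:] * R'" by (simp add: algebra_simps)
  define S' where "S' = [:- a, 1:] ^ e * S1"
  have S_S': "S = [:- a, 1:] * S'" unfolding S S'_def power_Suc by (rule mult.assoc)
  have "S' \<noteq> 0" "S1 \<noteq> 0" using \<open>S \<noteq> 0\<close> S_S' by (auto simp: S'_def)
  \<comment> \<open>splitting off the dominant pole leaves a fraction whose poles on the critical circle have
    order at most \<open>e\<close>\<close>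
  have small: "(\<lambda>n. cmod (fps_nth (fps_of_poly R' / fps_of_poly S') n) * s ^ n) \<in> o(\<lambda>n. real n ^ e)"
  proof (rule rational_coeff_smallo[OF s])
    show "s \<le> cmod z" if "poly S' z = 0" for z using roots[of z] that S_S' by auto
    fix z assume z: "cmod z = s"
    have order: "order z S = order z [:- a, 1:] + order z S'"
      unfolding S_S' using \<open>S \<noteq> 0\<close> S_S' by (intro order_mult) auto
    show "order z S' \<le> e"
    proof (cases "z = a")
      case True
      then show ?thesis using order e order_power_n_n[of a 1] by simp
    next
      case False
      then show ?thesis using dominant[OF z] order e by (simp add: a_def)
    qed
  qed
  have frac: "fps_of_poly R / fps_of_poly S
      = fps_const c * inverse (fps_of_poly [:- a, 1:] ^ Suc e) + fps_of_poly R' / fps_of_poly S'"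
  proof -
    let ?A = "fps_of_poly [:- a, 1:]"
    have unit: "fps_nth (fps_of_poly S) 0 \<noteq> 0" "fps_nth (fps_of_poly S') 0 \<noteq> 0"
      "fps_nth (fps_of_poly S1) 0 \<noteq> 0" "fps_nth ?A 0 \<noteq> 0"
      using S0 S S_S' a by (auto simp: poly_0_coeff_0 S'_def coeff_mult)
    note inv = inverse_mult_eq_1'[OF unit(3)] inverse_mult_eq_1'[OF unit(4)]
    have "fps_of_poly R / fps_of_poly S
        = (fps_const c * fps_of_poly S1 + ?A * fps_of_poly R') * inverse (fps_of_poly S)"
      unfolding fps_divide_unit[OF unit(1)] R' by (simp add: fps_of_poly_add fps_of_poly_mult fps_of_poly_smult)
    also have "\<dots> = fps_const c * (fps_of_poly S1 * inverse (fps_of_poly S1)) * inverse (?A ^ Suc e)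
        + (?A * inverse ?A) * (fps_of_poly R' * inverse (fps_of_poly S'))"
    proof -
      have inv1: "inverse (fps_of_poly S) = inverse (?A ^ Suc e) * inverse (fps_of_poly S1)"
        unfolding S fps_of_poly_mult fps_of_poly_power fps_inverse_mult ..
      have inv2: "inverse (fps_of_poly S) = inverse ?A * inverse (fps_of_poly S')"
        unfolding S_S' fps_of_poly_mult fps_inverse_mult ..
      have "fps_const c * fps_of_poly S1 * inverse (fps_of_poly S)
          = fps_const c * (fps_of_poly S1 * inverse (fps_of_poly S1)) * inverse (?A ^ Suc e)"
        unfolding inv1 by (simp only: mult_ac)
      moreover have "?A * fps_of_poly R' * inverse (fps_of_poly S)
          = (?A * inverse ?A) * (fps_of_poly R' * inverse (fps_of_poly S'))"
        unfolding inv2 by (simp only: mult_ac)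
      ultimately show ?thesis by (simp only: distrib_right)
    qed
    finally show ?thesis unfolding inv fps_divide_unit[OF unit(2)] by simp
  qed
  define G where "G = c * (- 1 / a) ^ Suc e"
  have G: "G \<noteq> 0" using c a by (simp add: G_def)
  define f where "f = fps_nth (fps_of_poly R' / fps_of_poly S')"
  define h where "h = (\<lambda>n. real (u n) * s ^ n / real n ^ e)"
  have un: "of_nat (u n) = coeff T n + G * of_nat ((n + e) choose e) / a ^ n + f n" for n
  proof -
    have "of_nat (u n) = fps_nth (Abs_fps (\<lambda>n. of_nat (u n) :: complex)) n" by simp
    also have "\<dots> = coeff T n + c * fps_nth (inverse (fps_of_poly [:- a, 1:] ^ Suc e)) n + f n"
      unfolding u frac f_def by (simp add: add.assoc)
    finally show ?thesis unfolding fps_nth_inverse_root_power[OF a(1)] G_def by simp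
  qed
  have "(\<lambda>n. G * of_real (real ((n + e) choose e) / real n ^ e) + f n * a ^ n / of_nat n ^ e)
          \<longlonglongrightarrow> G * of_real (1 / fact e) + 0"
  proof (intro tendsto_add tendsto_mult[OF tendsto_const] tendsto_of_real binomial_power_limit)
    have "(\<lambda>n. cmod (f n) * s ^ n / real n ^ e) \<longlonglongrightarrow> 0"
      using smalloD_tendsto[OF small] by (simp add: f_def)
    then have "(\<lambda>n. cmod (f n * a ^ n / of_nat n ^ e)) \<longlonglongrightarrow> 0"
      using a(2) by (simp add: norm_mult norm_divide norm_power)
    then show "(\<lambda>n. f n * a ^ n / of_nat n ^ e) \<longlonglongrightarrow> 0"
      by (rule tendsto_norm_zero_cancel)
  qed
  moreover have "eventually (\<lambda>n. G * of_real (real ((n + e) choose e) / real n ^ e) + f n * a ^ n / of_nat n ^ e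
                  = of_real (h n)) sequentially"
    using eventually_gt_at_top[of "degree T"]
  proof eventually_elim
    case (elim n)
    then have "coeff T n = 0" by (simp add: coeff_eq_0)
    have "of_real (h n) = of_nat (u n) * a ^ n / of_nat n ^ e" by (simp add: h_def a_def)
    also have "\<dots> = G * of_real (real ((n + e) choose e) / real n ^ e) + f n * a ^ n / of_nat n ^ e"
      unfolding un \<open>coeff T n = 0\<close> using a(1) by (simp add: distrib_right add_divide_distrib)
    finally show ?case by simp
  qed
  ultimately have h: "(\<lambda>n. of_real (h n)) \<longlonglongrightarrow> G / fact e"
    by (simp add: tendsto_cong)
  define l where "l = Re (G / fact e)"
  have hl: "h \<longlonglongrightarrow> l" using tendsto_Re[OF h] by (simp add: l_def)
  then have "(\<lambda>n. complex_of_real (h n)) \<longlonglongrightarrow> of_real l" by (rule tendsto_of_real)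
  from LIMSEQ_unique[OF this h] have l: "l \<noteq> 0" using G by auto
  have "(\<lambda>n. h (Suc n) / h n * (1 / s) * ((real n + 1) / real n) ^ e) \<longlonglongrightarrow> l / l * (1 / s) * 1 ^ e"
  proof (intro tendsto_intros hl l LIMSEQ_Suc)
    show "(\<lambda>n. (real n + 1) / real n) \<longlonglongrightarrow> 1" by real_asymp
  qed
  moreover have "eventually (\<lambda>n. h (Suc n) / h n * (1 / s) * ((real n + 1) / real n) ^ e
                  = real (u (Suc n)) / real (u n)) sequentially"
    using eventually_gt_at_top[of 0]
  proof eventually_elim
    case (elim n)
    then show ?case
      using s by (simp add: h_def power_divide field_simps)
  qed
  ultimately show ?thesis using l by (simp add: tendsto_cong)
qed

section \<open>Growth of a language and its modulus\<close>

text \<open>The eigenvalues are the inverses of the poles of the generating function, with the same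
  multiplicities.\<close>

lemma eigenvalues_denominator:
  assumes S: "eigen_poly_complex K = reflect_poly S" "poly S 0 \<noteq> 0"
  shows "finite (eigenvalues K)" "0 \<notin> eigenvalues K"
    and "x \<noteq> 0 \<Longrightarrow> x \<in> eigenvalues K \<longleftrightarrow> poly S (inverse x) = 0"
    and "x \<noteq> 0 \<Longrightarrow> eigen_mult K x = order (inverse x) S"
    and "degree S > 0 \<Longrightarrow> eigenvalues K \<noteq> {}"
proof -
  have nz: "S \<noteq> 0" using S(2) by auto
  show "finite (eigenvalues K)"
    unfolding eigenvalues_def S(1) using nz by (intro poly_roots_finite) simp
  show "0 \<notin> eigenvalues K" unfolding eigenvalues_def S(1) using nz by simp
  show "x \<in> eigenvalues K \<longleftrightarrow> poly S (inverse x) = 0" if "x \<noteq> 0"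
    unfolding eigenvalues_def S(1) using that by (simp add: poly_reflect_poly_nz)
  show "eigen_mult K x = order (inverse x) S" if "x \<noteq> 0"
    unfolding eigen_mult_def S(1) using order_reflect_poly[OF nz, of "inverse x"] that by simp
  assume "degree S > 0"
  then have "\<not> constant (poly (reflect_poly S))"
    using S(2) by (simp add: constant_degree poly_0_coeff_0)
  then show "eigenvalues K \<noteq> {}"
    unfolding eigenvalues_def S(1) using fundamental_theorem_of_algebra by auto
qed

lemma modulus_denominator:
  assumes S: "eigen_poly_complex K = reflect_poly S" "poly S 0 \<noteq> 0" "degree S > 0"
  shows "lang_modulus K > 0" "\<And>z. poly S z = 0 \<Longrightarrow> 1 / lang_modulus K \<le> cmod z"
    and "\<exists>x\<in>eigenvalues K. cmod x = lang_modulus K"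
proof -
  note E = eigenvalues_denominator[OF S(1,2)]
  have "lang_modulus K \<in> cmod ` eigenvalues K"
    unfolding lang_modulus_def using E(1) E(5)[OF S(3)] by (intro Max_in) auto
  then show ex: "\<exists>x\<in>eigenvalues K. cmod x = lang_modulus K" by auto
  then show pos: "lang_modulus K > 0" using E(2) by (metis zero_less_norm_iff)
  fix z assume z: "poly S z = 0"
  then have "z \<noteq> 0" using S(2) by auto
  then have "inverse z \<in> eigenvalues K" using E(3)[of "inverse z"] z by simp
  then have "cmod (inverse z) \<le> lang_modulus K"
    unfolding lang_modulus_def using E(1) by simp
  then show "1 / lang_modulus K \<le> cmod z"
    unfolding norm_inverse using \<open>z \<noteq> 0\<close> pos by (simp add: field_simps)
qed

text \<open>For an adev language the modulus \<open>\<mu>\<close> is an eigenvalue by definition alone: some eigenvalue has modulus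
  \<open>\<mu>\<close>, and if it is not \<open>\<mu>\<close> itself, its multiplicity is less than that of \<open>\<mu>\<close>, which is therefore
  positive. So \<open>1 / \<mu>\<close> is the dominant pole.\<close>

lemma adev_ratio:
  assumes K: "rational_fps (gen_fun K)" "\<And>n. num_words K n > 0" and "adev K"
  shows "(\<lambda>n. real (num_words K (Suc n)) / real (num_words K n)) \<longlonglongrightarrow> lang_modulus K"
proof -
  obtain S T R where S: "eigen_poly_complex K = reflect_poly S" "poly S 0 \<noteq> 0" "degree S > 0"
    and R: "\<And>z. poly S z = 0 \<Longrightarrow> poly R z \<noteq> 0"
    and gen: "word_series K = fps_of_poly T + fps_of_poly R / fps_of_poly S"
    by (rule eigen_poly_denominator[OF K]) (rule that)
  note E = eigenvalues_denominator[OF S(1,2)] and M = modulus_denominator[OF S]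
  define \<mu> where "\<mu> = lang_modulus K"
  have \<mu>: "\<mu> > 0" using M(1) by (simp add: \<mu>_def)
  have nz: "S \<noteq> 0" using S(2) by auto
  have adev: "eigen_mult K x < eigen_mult K (of_real \<mu>)"
    if "x \<in> eigenvalues K" "cmod x = \<mu>" "x \<noteq> of_real \<mu>" for x
    using \<open>adev K\<close> that unfolding adev_def \<mu>_def by blast
  obtain x where x: "x \<in> eigenvalues K" "cmod x = \<mu>" using M(3) by (auto simp: \<mu>_def)
  define w where "w = complex_of_real (1 / \<mu>)"
  have w: "inverse (of_real \<mu>) = w" "of_real \<mu> = inverse w" "complex_of_real \<mu> \<noteq> 0"
    using \<mu> by (simp_all add: w_def inverse_eq_divide)
  have root: "poly S w = 0"
  proof (cases "x = of_real \<mu>")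
    case True
    then show ?thesis using E(3)[OF w(3)] x(1) w(1) by simp
  next
    case False
    then have "order w S \<noteq> 0"
      using adev[OF x] E(4)[OF w(3)] unfolding w(1) by linarith
    then show ?thesis using nz by (simp add: order_root)
  qed
  have "(\<lambda>n. real (num_words K (Suc n)) / real (num_words K n)) \<longlonglongrightarrow> 1 / (1 / \<mu>)"
  proof (rule dominant_pole_ratio[OF gen], unfold w_def[symmetric])
    show "poly S w = 0" by (rule root)
    then show "poly R w \<noteq> 0" by (rule R)
    show "1 / \<mu> \<le> cmod z" if "poly S z = 0" for z using M(2)[OF that] by (simp add: \<mu>_def)
    fix z assume z: "cmod z = 1 / \<mu>" "z \<noteq> w"
    have z0: "inverse z \<noteq> 0" using z(1) \<mu> by auto
    show "order z S < order w S"
    proof (cases "poly S z = 0")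
      case True
      have "inverse z \<in> eigenvalues K" using True E(3)[OF z0] by simp
      moreover have "cmod (inverse z) = \<mu>" unfolding norm_inverse z(1) by simp
      moreover have "inverse z \<noteq> of_real \<mu>" unfolding w(2) using z(2) by simp
      ultimately have "eigen_mult K (inverse z) < eigen_mult K (of_real \<mu>)" by (rule adev)
      then show ?thesis unfolding E(4)[OF z0] E(4)[OF w(3)] w(1) by simp
    next
      case False
      moreover have "order w S > 0" using root nz by (simp add: order_gt_0_iff)
      ultimately show ?thesis by (simp add: order_0I)
    qed
  qed (use \<mu> in simp)
  then show ?thesis by (simp add: \<mu>_def)
qed

text \<open>All poles of the generating function lie outside the closed disc of radius \<open>1 / \<rho>\<close>.\<close>

lemma num_words_below_modulus:
  assumes K: "rational_fps (gen_fun K)" "\<And>n. num_words K n > 0" and \<rho>: "lang_modulus K < \<rho>"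
  shows "(\<lambda>n. real (num_words K n) / \<rho> ^ n) \<longlonglongrightarrow> 0"
proof -
  obtain S T R where S: "eigen_poly_complex K = reflect_poly S" "poly S 0 \<noteq> 0" "degree S > 0"
    and "\<And>z. poly S z = 0 \<Longrightarrow> poly R z \<noteq> 0"
    and gen: "word_series K = fps_of_poly T + fps_of_poly R / fps_of_poly S"
    by (rule eigen_poly_denominator[OF K]) (rule that)
  note M = modulus_denominator[OF S]
  have pos: "\<rho> > 0" "1 / \<rho> < 1 / lang_modulus K" using M(1) \<rho> by (auto intro: divide_strict_left_mono)
  have "(\<lambda>n. cmod (fps_nth (fps_of_poly R / fps_of_poly S) n) * (1 / \<rho>) ^ n) \<longlonglongrightarrow> 0"
    by (rule rational_coeff_tendsto_0) (use pos M(2) in \<open>auto intro: less_le_trans\<close>)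
  moreover have "eventually (\<lambda>n. cmod (fps_nth (fps_of_poly R / fps_of_poly S) n) * (1 / \<rho>) ^ n
      = real (num_words K n) / \<rho> ^ n) sequentially"
    using eventually_gt_at_top[of "degree T"]
  proof eventually_elim
    case (elim n)
    have "of_nat (num_words K n) = fps_nth (word_series K) n" by simp
    also have "\<dots> = fps_nth (fps_of_poly R / fps_of_poly S) n"
      unfolding gen using elim by (simp add: coeff_eq_0)
    finally have "cmod (fps_nth (fps_of_poly R / fps_of_poly S) n) = real (num_words K n)"
      by (metis norm_of_nat)
    then show ?case by (simp add: power_divide)
  qed
  ultimately show ?thesis by (simp add: tendsto_cong)
qed

text \<open>Otherwise the generating function converges at a pole \<open>z\<close>; multiplying it by the denominator
  and evaluating at \<open>z\<close> shows that the numerator vanishes there too.\<close>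

lemma modulus_le_growth:
  assumes K: "rational_fps (gen_fun K)" "\<And>n. num_words K n > 0"
    and \<rho>: "\<rho> > 0" and bound: "\<And>n. real (num_words K n) \<le> C * \<rho> ^ n"
  shows "lang_modulus K \<le> \<rho>"
proof (rule ccontr)
  assume "\<not> lang_modulus K \<le> \<rho>"
  then have less: "\<rho> < lang_modulus K" by simp
  obtain S T R where S: "eigen_poly_complex K = reflect_poly S" "poly S 0 \<noteq> 0" "degree S > 0"
    and R: "\<And>z. poly S z = 0 \<Longrightarrow> poly R z \<noteq> 0"
    and gen: "word_series K = fps_of_poly T + fps_of_poly R / fps_of_poly S"
    by (rule eigen_poly_denominator[OF K]) (rule that)
  note E = eigenvalues_denominator[OF S(1,2)] and M = modulus_denominator[OF S]
  obtain x where x: "x \<in> eigenvalues K" "cmod x = lang_modulus K" using M(3) by auto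
  define z where "z = inverse x"
  have "x \<noteq> 0" using x E(2) by auto
  then have z: "poly S z = 0" using E(3)[of x] x by (simp add: z_def)
  have "cmod z < 1 / \<rho>"
    unfolding z_def norm_inverse x(2) using less \<rho> by (simp add: field_simps)
  then obtain t where t: "cmod z < t" "t < 1 / \<rho>" using dense by blast
  have t0: "t > 0" using t(1) norm_ge_zero[of z] by linarith
  have "summable (\<lambda>n. fps_nth (word_series K) n * (complex_of_real t) ^ n)"
  proof (rule summable_comparison_test')
    have "\<rho> * t < 1" using t \<rho> by (simp add: field_simps)
    then show "summable (\<lambda>n. C * (\<rho> * t) ^ n)"
      using t0 \<rho> by (intro summable_mult summable_geometric) simp
    fix n
    have "real (num_words K n) * t ^ n \<le> C * \<rho> ^ n * t ^ n"
      using bound t0 by (intro mult_right_mono) auto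
    then show "norm (fps_nth (word_series K) n * (complex_of_real t) ^ n) \<le> C * (\<rho> * t) ^ n"
      using t0 by (simp add: norm_mult norm_power power_mult_distrib mult.assoc)
  qed
  from conv_radius_geI[OF this] have "ereal t \<le> fps_conv_radius (word_series K)"
    using t0 by (simp add: fps_conv_radius_def)
  then have rad: "ereal (cmod z) < fps_conv_radius (word_series K)"
    using t(1) by (metis ereal_less(1) less_ereal.simps(1) less_le_trans)
  have unit: "fps_nth (fps_of_poly S) 0 \<noteq> 0" using S(2) by (simp add: poly_0_coeff_0)
  have "word_series K * fps_of_poly S = fps_of_poly (T * S + R)"
    unfolding gen fps_divide_unit[OF unit]
    using inverse_mult_eq_1[OF unit] by (simp add: fps_of_poly_add fps_of_poly_mult algebra_simps)
  then have "eval_fps (word_series K) z * poly S z = poly (T * S + R) z"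
    using eval_fps_mult[OF rad, of "fps_of_poly S"] by simp
  then show False using z R[OF z] by simp
qed

text \<open>Eventually \<open>u n / \<rho> ^ n\<close> does not decrease, so its minimum over an initial segment is a
  global lower bound.\<close>

lemma geometric_lower_bound:
  fixes u :: "nat \<Rightarrow> real"
  assumes pos: "\<And>n. u n > 0" and "\<rho> > 0" and step: "eventually (\<lambda>n. \<rho> * u n \<le> u (Suc n)) sequentially"
  shows "\<exists>c>0. \<forall>n. c * \<rho> ^ n \<le> u n"
proof -
  obtain N where N: "\<rho> * u n \<le> u (Suc n)" if "n \<ge> N" for n
    using step by (auto simp: eventually_sequentially)
  define v where "v n = u n / \<rho> ^ n" for n
  define c where "c = Min (v ` {..N})"
  have le: "c \<le> v n" if "n \<le> N" for n unfolding c_def using that by (intro Min_le) auto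
  have "c \<le> v n" for n
  proof (cases "n \<le> N")
    case False
    then have "N \<le> n" by simp
    then show ?thesis
    proof (induction n rule: dec_induct)
      case base
      show ?case using le by simp
    next
      case (step n)
      have "v n \<le> v (Suc n)"
        using N[OF step.hyps(1)] \<open>\<rho> > 0\<close> by (simp add: v_def field_simps)
      with step.IH show ?case by (rule order_trans)
    qed
  qed (use le in simp)
  then have "c * \<rho> ^ n \<le> u n" for n
    using \<open>\<rho> > 0\<close> by (simp add: v_def pos_le_divide_eq)
  moreover have "c > 0" unfolding c_def v_def using pos \<open>\<rho> > 0\<close> by (subst Min_gr_iff) auto
  ultimately show ?thesis by blast
qed

text \<open>The reciprocals satisfy the hypotheses of the lower bound with \<open>1 / \<rho>\<close>.\<close>

lemma geometric_upper_bound: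
  fixes u :: "nat \<Rightarrow> real"
  assumes pos: "\<And>n. u n > 0" and "\<rho> > 0" and step: "eventually (\<lambda>n. u (Suc n) \<le> \<rho> * u n) sequentially"
  shows "\<exists>C. \<forall>n. u n \<le> C * \<rho> ^ n"
proof -
  have "eventually (\<lambda>n. 1 / \<rho> * (1 / u n) \<le> 1 / u (Suc n)) sequentially"
    using step
  proof eventually_elim
    case (elim n)
    then show ?case using pos[of "Suc n"] pos[of n] \<open>\<rho> > 0\<close> by (simp add: frac_le)
  qed
  from geometric_lower_bound[OF _ _ this]
  obtain c where c: "c > 0" "\<And>n. c * (1 / \<rho>) ^ n \<le> 1 / u n"
    using pos \<open>\<rho> > 0\<close> by auto
  have "u n \<le> 1 / c * \<rho> ^ n" for n
    using c(2)[of n] c(1) pos[of n] \<open>\<rho> > 0\<close> by (simp add: field_simps)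
  then show ?thesis by blast
qed

text \<open>By induction the sum of the terms before \<open>u n\<close> is at most \<open>u n / (\<rho> - 1)\<close> plus a constant, as for a
  geometric progression.\<close>

lemma partial_sums_bigo:
  fixes u :: "nat \<Rightarrow> real"
  assumes pos: "\<And>n. u n > 0" and "\<rho> > 1" and step: "eventually (\<lambda>n. \<rho> * u n \<le> u (Suc n)) sequentially"
    and inf: "(\<lambda>_. 1) \<in> o(u)"
  shows "(\<lambda>n. \<Sum>m<n. u m) \<in> O(u)"
proof -
  obtain N where N: "\<rho> * u n \<le> u (Suc n)" if "n \<ge> N" for n
    using step by (auto simp: eventually_sequentially)
  define C where "C = (\<Sum>m<N. u m)"
  have bound: "(\<Sum>m<n. u m) \<le> C + u n / (\<rho> - 1)" if "n \<ge> N" for n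
    using that
  proof (induction n rule: dec_induct)
    case base
    then show ?case using pos[of N] \<open>\<rho> > 1\<close> by (simp add: C_def)
  next
    case (step n)
    have "u n / (\<rho> - 1) + u n = \<rho> * u n / (\<rho> - 1)" using \<open>\<rho> > 1\<close> by (simp add: field_simps)
    also have "\<dots> \<le> u (Suc n) / (\<rho> - 1)"
      using N[OF step.hyps(1)] \<open>\<rho> > 1\<close> by (intro divide_right_mono) auto
    finally show ?case using step.IH by simp
  qed
  have "(\<lambda>n. \<Sum>m<n. u m) \<in> O(\<lambda>n. C + u n / (\<rho> - 1))"
  proof (rule landau_o.bigI[of 1])
    show "eventually (\<lambda>n. norm (\<Sum>m<n. u m) \<le> 1 * norm (C + u n / (\<rho> - 1))) sequentially"
      using eventually_ge_at_top[of N]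
    proof eventually_elim
      case (elim n)
      have "(\<Sum>m<n. u m) \<ge> 0" using pos by (simp add: sum_nonneg less_imp_le)
      then show ?case using bound[OF elim] by simp
    qed
  qed simp
  also have "(\<lambda>n. C + u n / (\<rho> - 1)) \<in> O(u)"
  proof (rule sum_in_bigo(1))
    show "(\<lambda>_. C) \<in> O(u)"
      using landau_o.big_small_trans[OF _ inf, of "\<lambda>_. C"] by (simp add: landau_o.small_imp_big)
    show "(\<lambda>n. u n / (\<rho> - 1)) \<in> O(u)" using \<open>\<rho> > 1\<close> by simp
  qed
  finally show ?thesis .
qed

text \<open>The factor \<open>\<lambda> / (\<lambda> - 1)\<close> is the one for which the increments of the defect vanish along a geometric
  progression of ratio \<open>\<lambda>\<close>.\<close>

lemma defect_eq:
  assumes "lam > 1"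
  shows "defect (lam / (lam - 1)) K m = defect (lam / (lam - 1)) K 0
     - (\<Sum>k<m. real (num_words K (Suc k)) - lam * real (num_words K k)) / (lam - 1)"
proof (induction m)
  case 0
  show ?case by simp
next
  case (Suc m)
  have "defect (lam / (lam - 1)) K (Suc m) = defect (lam / (lam - 1)) K m
      - (real (num_words K (Suc m)) - lam * real (num_words K m)) / (lam - 1)"
  proof -
    have "lam / (lam - 1) - 1 = 1 / (lam - 1)" using assms by (simp add: field_simps)
    then have step: "(x - lam * y) / (lam - 1) = (lam / (lam - 1) - 1) * x - lam / (lam - 1) * y" for x y
      by (simp add: diff_divide_distrib)
    show ?thesis unfolding step by (simp add: defect_def algebra_simps)
  qed
  then show ?case unfolding Suc.IH by (simp add: add_divide_distrib)
qed

lemma num_words_Suc_le: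
  assumes "pce_language {..<r} L"
  shows "num_words L (Suc n) \<le> r * num_words L n"
proof -
  have L: "L \<subseteq> lists {..<r}" using assms by (simp add: pce_language_def)
  have "{w \<in> L. length w = Suc n} \<subseteq> (\<lambda>(v, a). v @ [a]) ` ({w \<in> L. length w = n} \<times> {..<r})"
  proof
    fix w assume w: "w \<in> {w \<in> L. length w = Suc n}"
    then obtain v a where va: "w = v @ [a]" "length v = n" by (auto simp: length_Suc_conv_rev)
    moreover have "v \<in> L" using assms w va by (auto simp: pce_language_def)
    moreover have "a < r" using L w va by auto
    ultimately show "w \<in> (\<lambda>(v, a). v @ [a]) ` ({w \<in> L. length w = n} \<times> {..<r})" by auto
  qed
  then have "num_words L (Suc n) \<le> card ({w \<in> L. length w = n} \<times> {..<r})"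
    unfolding num_words_def using finite_words(1)[OF L] by (intro surj_card_le) auto
  then show ?thesis by (simp add: num_words_def mult.commute card_cartesian_product)
qed

lemma num_words_quotient_le:
  assumes "pce_language {..<r} L"
  shows "num_words (quotient_language w L) n \<le> r ^ length w * num_words L n"
proof -
  have L: "L \<subseteq> lists {..<r}" using assms by (simp add: pce_language_def)
  have "num_words (quotient_language w L) n \<le> num_words L (n + length w)"
    unfolding num_words_def
    by (rule card_inj_on_le[of "(@) w"]) (use finite_words(1)[OF L] in \<open>auto simp: quotient_language_def inj_on_def\<close>)
  also have "num_words L (n + k) \<le> r ^ k * num_words L n" for k
  proof (induction k)
    case (Suc k)
    have "num_words L (n + Suc k) \<le> r * num_words L (n + k)"
      using num_words_Suc_le[OF assms, of "n + k"] by simp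
    also have "\<dots> \<le> r * (r ^ k * num_words L n)" using Suc.IH by (rule mult_le_mono2)
    finally show ?case by (simp add: mult.assoc)
  qed simp
  finally show ?thesis .
qed

section \<open>The carry propagation\<close>

theorem theorem4p10:
  fixes r :: nat and L :: "nat list set" and lam :: real
  assumes "rational_language {..<r} L"
    and "pce_language {..<r} L"
    and "L \<noteq> {}"
    and "adev L"
    and "lam = lang_modulus L"
    and "lam > 1"
    and "\<And>w. w \<in> lists {..<r} \<Longrightarrow> quotient_language w L \<noteq> {} \<Longrightarrow>
           lang_modulus (quotient_language w L) = lam \<Longrightarrow> adev (quotient_language w L)"
  shows "has_carry_propagation L \<and> CP L = lam / (lam - 1)"
proof -
  interpret pce_numeration r L by unfold_locales (fact assms)+
  note adev_quotients = assms(7)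
  have quotient_Nil: "quotient_language [] L = L" by (simp add: quotient_language_def)
  have rational: "rational_fps (gen_fun (quotient_language w L))" for w
    by (rule rational_gen_fun[OF assms(1) words])
  have quotient_pos: "num_words (quotient_language w L) n > 0" if "quotient_language w L \<noteq> {}" for w n
    using pce_numeration.num_words_pos[of r "quotient_language w L"] that
      pce_numeration.intro[OF pce_quotient[OF pce]] by blast
  define u where "u n = real (num_words L n)" for n
  have u_pos: "u n > 0" for n using num_words_pos by (simp add: u_def)
  have ratio: "(\<lambda>n. u (Suc n) / u n) \<longlonglongrightarrow> lam"
    using adev_ratio[of L] rational[of "[]"] num_words_pos assms(4,5) unfolding quotient_Nil u_def by simp
  have lower: "eventually (\<lambda>n. \<rho> * u n \<le> u (Suc n)) sequentially" if "\<rho> < lam" for \<rho>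
    using order_tendstoD(1)[OF ratio that]
  proof eventually_elim
    case (elim n)
    then show ?case using u_pos[of n] by (simp add: pos_less_divide_eq)
  qed
  have upper: "eventually (\<lambda>n. u (Suc n) \<le> \<rho> * u n) sequentially" if "\<rho> > lam" for \<rho>
    using order_tendstoD(2)[OF ratio that]
  proof eventually_elim
    case (elim n)
    then show ?case using u_pos[of n] by (simp add: pos_divide_less_eq)
  qed
  have power_bigo: "(\<lambda>n. \<rho> ^ n) \<in> O(u)" if \<rho>: "0 < \<rho>" "\<rho> < lam" for \<rho>
  proof -
    obtain c where c: "c > 0" "\<And>n. c * \<rho> ^ n \<le> u n"
      using geometric_lower_bound[OF u_pos \<rho>(1) lower[OF \<rho>(2)]] by blast
    have "\<rho> ^ n \<le> 1 / c * u n" for n using c(1) c(2)[of n] by (simp add: field_simps)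
    then show ?thesis
      using \<rho>(1) u_pos by (intro landau_o.bigI[of "1 / c"] always_eventually allI)
        (use c(1) in \<open>simp_all add: less_imp_le abs_of_pos\<close>)
  qed
  \<comment> \<open>any rate strictly between \<open>1\<close> and the modulus shows that \<open>u\<close> grows exponentially\<close>
  obtain \<rho> where \<rho>: "1 < \<rho>" "\<rho> < lam" using dense[OF assms(6)] by blast
  have "(\<lambda>_. 1) \<in> o(\<lambda>n. \<rho> ^ n)" using \<rho>(1) by real_asymp
  then have one_o: "(\<lambda>_. 1) \<in> o(u)"
    by (rule landau_o.small_big_trans[OF _ power_bigo]) (use \<rho> in auto)
  have sums_O: "(\<lambda>n. \<Sum>m<n. u m) \<in> O(u)"
    by (rule partial_sums_bigo[OF u_pos \<rho>(1) lower[OF \<rho>(2)] one_o])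
  have shift_O: "(\<lambda>n. u (Suc n)) \<in> O(u)"
  proof (rule landau_o.bigI[of "lam + 1"])
    show "eventually (\<lambda>n. norm (u (Suc n)) \<le> (lam + 1) * norm (u n)) sequentially"
      using upper[of "lam + 1"] u_pos by (simp add: less_imp_le abs_of_pos)
  qed (use assms(6) in simp)
  have quotient_O: "(\<lambda>n. real (num_words (quotient_language w L) n)) \<in> O(u)" for w
  proof -
    have "real (num_words (quotient_language w L) n) \<le> real (r ^ length w) * u n" for n
      using num_words_quotient_le[OF pce, of w n] unfolding u_def by (metis of_nat_le_iff of_nat_mult)
    also have "real (r ^ length w) * u n \<le> (real (r ^ length w) + 1) * norm (u n)" for n
      using u_pos[of n] by (simp add: distrib_right)
    finally show ?thesis
      by (intro landau_o.bigI[of "real (r ^ length w) + 1"] always_eventually allI)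
        (simp_all add: add_nonneg_pos)
  qed
  define \<alpha> where "\<alpha> = lam / (lam - 1)"
  have defect_o: "(\<lambda>m. defect \<alpha> (quotient_language w L) m) \<in> o(u)" for w
  proof (cases "quotient_language w L = {}")
    case True
    then show ?thesis by (simp add: defect_def num_words_def)
  next
    case False
    define q where "q n = real (num_words (quotient_language w L) n)" for n
    have q_pos: "q n > 0" for n using quotient_pos[OF False] by (simp add: q_def)
    define \<mu> where "\<mu> = lang_modulus (quotient_language w L)"
    have "w \<in> lists {..<r}"
      using False words by (auto simp: quotient_language_def)
    \<comment> \<open>a quotient does not grow faster than the language\<close>
    have "\<mu> \<le> lam"
    proof (rule ccontr)
      assume "\<not> \<mu> \<le> lam"
      then have "lam < \<mu>" by simp
      from dense[OF this] obtain \<sigma> where \<sigma>: "lam < \<sigma>" "\<sigma> < \<mu>" by blast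
      then have "\<sigma> > 0" using assms(6) by simp
      obtain C where C: "\<And>n. u n \<le> C * \<sigma> ^ n"
        using geometric_upper_bound[OF u_pos \<open>\<sigma> > 0\<close> upper[OF \<sigma>(1)]] by blast
      have "q n \<le> real (r ^ length w) * C * \<sigma> ^ n" for n
      proof -
        have "q n \<le> real (r ^ length w) * u n"
          using num_words_quotient_le[OF pce, of w n] unfolding u_def q_def by (metis of_nat_le_iff of_nat_mult)
        also have "\<dots> \<le> real (r ^ length w) * (C * \<sigma> ^ n)" by (intro mult_left_mono C) simp
        finally show ?thesis by (simp only: mult.assoc)
      qed
      then have "\<mu> \<le> \<sigma>"
        unfolding \<mu>_def q_def by (intro modulus_le_growth rational quotient_pos False \<open>\<sigma> > 0\<close>)
      with \<sigma> show False by simp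
    qed
    then consider "\<mu> = lam" | "\<mu> < lam" by linarith
    \<comment> \<open>dominant pole at \<open>1 / lam\<close> in the first case, exponentially few words in the second\<close>
    then have step_o: "(\<lambda>n. q (Suc n) - lam * q n) \<in> o(u)"
    proof cases
      case 1
      then have "(\<lambda>n. q (Suc n) / q n) \<longlonglongrightarrow> lam"
        using adev_ratio[OF rational quotient_pos[OF False]] adev_quotients[OF \<open>w \<in> lists {..<r}\<close> False]
        unfolding q_def \<mu>_def by simp
      then have "(\<lambda>n. q (Suc n) / q n - lam) \<longlonglongrightarrow> lam - lam" by (intro tendsto_intros)
      moreover have "q (Suc n) / q n - lam = (q (Suc n) - lam * q n) / q n" for n
        using q_pos[of n] by (simp add: field_simps)
      ultimately have "(\<lambda>n. q (Suc n) - lam * q n) \<in> o(q)"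
        using q_pos by (intro smalloI_tendsto) (auto simp: less_imp_neq[symmetric])
      then show ?thesis using quotient_O[of w] unfolding q_def[symmetric] by (rule landau_o.small_big_trans)
    next
      case 2
      have "max 0 \<mu> < lam" using 2 assms(6) by simp
      from dense[OF this] obtain \<sigma> where \<sigma>: "max 0 \<mu> < \<sigma>" "\<sigma> < lam" by blast
      have "(\<lambda>n. q n / \<sigma> ^ n) \<longlonglongrightarrow> 0"
        unfolding q_def by (rule num_words_below_modulus[OF rational quotient_pos[OF False]]) (use \<sigma> \<mu>_def in auto)
      then have "q \<in> o(\<lambda>n. \<sigma> ^ n)"
        using \<sigma>(1) by (intro smalloI_tendsto) auto
      then have q_o: "q \<in> o(u)"
        by (rule landau_o.small_big_trans[OF _ power_bigo]) (use \<sigma> in auto)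
      have "filterlim Suc sequentially sequentially" by (rule filterlim_Suc)
      from landau_o.small.compose[OF q_o this] have "(\<lambda>n. q (Suc n)) \<in> o(\<lambda>n. u (Suc n))" .
      then have "(\<lambda>n. q (Suc n)) \<in> o(u)" using shift_O by (rule landau_o.small_big_trans)
      moreover have "(\<lambda>n. lam * q n) \<in> o(u)" using q_o by simp
      ultimately show ?thesis by (rule sum_in_smallo(2))
    qed
    have sum_o: "(\<lambda>m. \<Sum>k<m. q (Suc k) - lam * q k) \<in> o(u)"
    proof (rule landau_o.big_small_trans)
      show "(\<lambda>m. \<Sum>k<m. \<bar>q (Suc k) - lam * q k\<bar>) \<in> o(u)"
        by (rule sum_smallo[OF step_o less_imp_le[OF u_pos] sums_O one_o])
      show "(\<lambda>m. \<Sum>k<m. q (Suc k) - lam * q k) \<in> O(\<lambda>m. \<Sum>k<m. \<bar>q (Suc k) - lam * q k\<bar>)"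
      proof (intro landau_o.bigI[of 1] always_eventually allI)
        fix m show "norm (\<Sum>k<m. q (Suc k) - lam * q k) \<le> 1 * norm (\<Sum>k<m. \<bar>q (Suc k) - lam * q k\<bar>)"
          using sum_abs[of "\<lambda>k. q (Suc k) - lam * q k" "{..<m}"] by simp
      qed simp
    qed
    have "(\<lambda>_. defect \<alpha> (quotient_language w L) 0) \<in> o(u)"
      using landau_o.big_small_trans[OF _ one_o, of "\<lambda>_. defect \<alpha> (quotient_language w L) 0"] by simp
    moreover have "(\<lambda>m. (\<Sum>k<m. q (Suc k) - lam * q k) / (lam - 1)) \<in> o(u)"
      using sum_o assms(6) by simp
    ultimately have "(\<lambda>m. defect \<alpha> (quotient_language w L) 0 - (\<Sum>k<m. q (Suc k) - lam * q k) / (lam - 1)) \<in> o(u)"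
      by (rule sum_in_smallo(2))
    then show ?thesis unfolding q_def \<alpha>_def defect_eq[OF assms(6), symmetric] .
  qed
  define \<Q> where "\<Q> = range (\<lambda>w. quotient_language w L)"
  have fin: "finite \<Q>" unfolding \<Q>_def by (rule finite_quotients[OF assms(1)])
  have closed: "quotient_language [a] K \<in> \<Q>" if K: "K \<in> \<Q>" for K a
  proof -
    obtain w where "K = quotient_language w L" using K by (auto simp: \<Q>_def)
    then have "quotient_language [a] K = quotient_language (w @ [a]) L" by (simp add: quotient_language_def)
    then show ?thesis by (simp add: \<Q>_def)
  qed
  have words_\<Q>: "K \<subseteq> lists {..<r}" if "K \<in> \<Q>" for K
    using that words by (auto simp: \<Q>_def quotient_language_def subset_iff)
  have "L \<in> \<Q>" unfolding \<Q>_def using quotient_Nil by (metis rangeI)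
  define E where "E m = (\<Sum>q\<in>\<Q>. \<bar>defect \<alpha> q m\<bar>)" for m
  have E_nonneg: "E m \<ge> 0" for m by (simp add: E_def sum_nonneg)
  have E_o: "E \<in> o(u)"
    unfolding E_def by (rule big_sum_in_smallo) (use defect_o in \<open>auto simp: \<Q>_def\<close>)
  have deviation: "\<bar>(\<Sum>i<N. real (cp L i)) - \<alpha> * real N\<bar> \<le> (1 + real r) * (\<Sum>m<length (radix_enum L N). E m)" for N
  proof -
    define w n where "w = radix_enum L N" and "n = length w"
    let ?G = "(\<Sum>k\<le>n. real (lex_rank L (take k w))) - \<alpha> * real (lex_rank L w)"
    have "(\<Sum>i<N. real (cp L i)) = real (\<Sum>i<N. cp L i)" by simp
    also have "\<dots> = (\<Sum>l<n. \<Sum>k\<le>l. real (num_words L k)) + (\<Sum>k\<le>n. real (lex_rank L (take k w)))"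
      unfolding sum_cp_eq w_def n_def by simp
    finally have sum_cp: "(\<Sum>i<N. real (cp L i))
        = (\<Sum>l<n. \<Sum>k\<le>l. real (num_words L k)) + (\<Sum>k\<le>n. real (lex_rank L (take k w)))" .
    have "real N = real ((\<Sum>l<n. num_words L l) + lex_rank L w)"
      using rank_eq[of N] by (simp add: w_def n_def)
    then have rank: "real N = (\<Sum>l<n. real (num_words L l)) + real (lex_rank L w)" by simp
    have eq: "(\<Sum>i<N. real (cp L i)) - \<alpha> * real N = (\<Sum>l<n. defect \<alpha> L l) + ?G"
      unfolding sum_cp rank by (simp add: defect_def sum_subtractf sum_distrib_left algebra_simps)
    have "\<bar>\<Sum>l<n. defect \<alpha> L l\<bar> \<le> (\<Sum>l<n. \<bar>defect \<alpha> L l\<bar>)" by (rule sum_abs)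
    also have "\<dots> \<le> (\<Sum>l<n. E l)"
      unfolding E_def by (intro sum_mono member_le_sum fin \<open>L \<in> \<Q>\<close>) auto
    finally have "\<bar>\<Sum>l<n. defect \<alpha> L l\<bar> \<le> (\<Sum>l<n. E l)" .
    moreover have "w \<in> lists {..<r}" using enum_mem words unfolding w_def by blast
    then have "\<bar>?G\<bar> \<le> real r * (\<Sum>m<n. E m)"
      unfolding n_def E_def by (rule lex_rank_defect_bound[OF _ \<open>L \<in> \<Q>\<close> fin words_\<Q> closed])
    ultimately show ?thesis
      unfolding eq w_def[symmetric] n_def[symmetric] by (simp add: distrib_right)
  qed
  have "cp_mean L \<longlonglongrightarrow> \<alpha>"
  proof (rule LIMSEQ_I)
    fix \<epsilon> :: real assume "\<epsilon> > 0"
    \<comment> \<open>one half of \<open>\<epsilon>\<close> is for the part proportional to \<open>N\<close>, the other half for the constant part\<close>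
    define \<delta> where "\<delta> = \<epsilon> / (2 * (1 + real r))"
    have "\<delta> > 0" using \<open>\<epsilon> > 0\<close> by (simp add: \<delta>_def)
    from sum_smallo_bound[OF E_o less_imp_le[OF u_pos] this]
    obtain C where C: "C \<ge> 0" "\<And>n. (\<Sum>m<n. \<bar>E m\<bar>) \<le> C + \<delta> * (\<Sum>m<n. u m)" by blast
    obtain N0 where N0: "real N0 > 2 * (1 + real r) * C / \<epsilon>" using reals_Archimedean2 by blast
    have "norm (cp_mean L N - \<alpha>) < \<epsilon>" if N: "N \<ge> Suc N0" for N
    proof -
      have "real N > 0" using N by simp
      have "(\<Sum>m<length (radix_enum L N). u m) = real (\<Sum>m<length (radix_enum L N). num_words L m)"
        by (simp add: u_def)
      also have "\<dots> \<le> real N" using rank_eq[of N] by linarith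
      finally have "\<delta> * (\<Sum>m<length (radix_enum L N). u m) \<le> \<delta> * real N"
        using \<open>\<delta> > 0\<close> by (intro mult_left_mono) auto
      with C(2)[of "length (radix_enum L N)"]
      have "(\<Sum>m<length (radix_enum L N). E m) \<le> C + \<delta> * real N" using E_nonneg by simp
      then have "(1 + real r) * (\<Sum>m<length (radix_enum L N). E m) \<le> (1 + real r) * (C + \<delta> * real N)"
        by (intro mult_left_mono) auto
      with deviation[of N] have "\<bar>(\<Sum>i<N. real (cp L i)) - \<alpha> * real N\<bar> \<le> (1 + real r) * (C + \<delta> * real N)"
        by (rule order_trans)
      also have "\<dots> = (1 + real r) * C + \<epsilon> / 2 * real N"
      proof -
        have "(1 + real r) * \<delta> = \<epsilon> / 2" by (simp add: \<delta>_def field_simps)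
        then show ?thesis by (simp add: distrib_left mult.assoc[symmetric])
      qed
      also have "(1 + real r) * C < \<epsilon> / 2 * real N"
      proof -
        have "2 * (1 + real r) * C / \<epsilon> < real N" using N0 N by linarith
        then show ?thesis using \<open>\<epsilon> > 0\<close> by (simp add: field_simps)
      qed
      finally have "\<bar>(\<Sum>i<N. real (cp L i)) - \<alpha> * real N\<bar> < \<epsilon> * real N" by simp
      moreover have "cp_mean L N - \<alpha> = ((\<Sum>i<N. real (cp L i)) - \<alpha> * real N) / real N"
        using \<open>real N > 0\<close> by (simp add: cp_mean_def field_simps)
      ultimately show ?thesis using \<open>real N > 0\<close> by (simp add: pos_divide_less_eq)
    qed
    then show "\<exists>N0. \<forall>N\<ge>N0. norm (cp_mean L N - \<alpha>) < \<epsilon>" by blast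
  qed
  then show ?thesis
    unfolding has_carry_propagation_def CP_def \<alpha>_def by (auto intro: convergentI limI)
qed

end
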